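(* For any $2\le k\le n-2$, the planar kinematics potential function $$\mathcal{S}^{(PK)}_{k,n}=\sum_{i=1}^n\log\left(\frac{p_{i,i+1,\ldots,i+(k-2),i+(k-1)}}{p_{i,i+1,\ldots,i+(k-2),i+k}}\right)$$ has at most $\mathcal{N}_{k,n}$ critical points in $\overline{X}(k,n)$, where $$\mathcal{N}_{k,n}=\frac1n\sum_{d\mid\gcd(k,n)}\mu(d)\binom{n/d}{k/d}$$ is the number of binary Lyndon words with $k$ ones and $n-k$ zeros.
   Context: Column indices are taken modulo $n$. For a complex $k\times n$ matrix $M$, $p_{i_1,\ldots,i_k}(M)$ is the determinant of the $k\times k$ matrix formed by columns $i_1,\ldots,i_k$ of $M$ in this order. $\mu$ is the Möbius function. A binary string is a Lyndon word if it is the unique lexicographically smallest element among its cyclic rotations. $\overline{X}(k,n)$ is the set of complex $k\times n$ matrices of rank $k$ with no zero column, modulo left multiplication by $SL(k)$ and right multiplication by the torus $(\mathbb{C}^* )^n$ of invertible diagonal matrices (equivalently, modulo $GL(k)\times(\mathbb{C}^* )^n$). The function $\mathcal{S}^{(PK)}_{k,n}$ is multivalued because of the logarithm, but its differential is well defined wherever all minors appearing in it are nonzero, and it is invariant (up to constants) under left multiplication by $GL(k)$ and under rescaling of columns. A critical point is a class $[M]\in\overline{X}(k,n)$ at which all minors appearing in $\mathcal{S}^{(PK)}_{k,n}$ are nonzero and all partial derivatives of $\mathcal{S}^{(PK)}_{k,n}$ with respect to the matrix entries vanish. *)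

theory Defs
  imports
    "HOL-Complex_Analysis.Complex_Analysis"
    "Jordan_Normal_Form.DL_Rank"
    "HOL-Computational_Algebra.Squarefree"
begin

text \<open>
  Matrices are those of Jordan Normal Form, so columns are numbered
  \<open>0, \<dots>, n - 1\<close>. Column indices are read modulo \<open>n\<close>, hence summing
  over \<open>i < n\<close> is the same as summing over \<open>i = 1, \<dots>, n\<close>.
\<close>

definition plucker :: "nat list \<Rightarrow> complex mat \<Rightarrow> complex" where
  "plucker cs M = det (mat_of_cols (dim_row M) (map (\<lambda>c. col M (c mod dim_col M)) cs))"

definition PK_num :: "nat \<Rightarrow> nat \<Rightarrow> complex mat \<Rightarrow> complex" where
  "PK_num k i M = plucker [i..<i + k] M"

definition PK_den :: "nat \<Rightarrow> nat \<Rightarrow> complex mat \<Rightarrow> complex" where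
  "PK_den k i M = plucker ([i..<i + (k - 1)] @ [i + k]) M"

definition PK_minors_nonzero :: "nat \<Rightarrow> nat \<Rightarrow> complex mat \<Rightarrow> bool" where
  "PK_minors_nonzero k n M \<longleftrightarrow> (\<forall>i<n. PK_num k i M \<noteq> 0 \<and> PK_den k i M \<noteq> 0)"

definition log_branch_at :: "(complex \<Rightarrow> complex) \<Rightarrow> complex \<Rightarrow> (complex \<Rightarrow> complex) \<Rightarrow> bool" where
  "log_branch_at f z L \<longleftrightarrow>
     (\<exists>U. open U \<and> z \<in> U \<and> L holomorphic_on U \<and> (\<forall>w\<in>U. exp (L w) = f w))"

text \<open>
  The potential is multivalued; a local determination of it is given by a choice of
  local branches of the \<open>n\<close> logarithms. \<open>PK_has_partial k n M a b D\<close> says that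
  \<open>D\<close> is the partial derivative at \<open>M\<close> of such a determination with respect to the
  \<open>(a, b)\<close> entry. Lemma \<open>PK_partial_ex1\<close> below shows that \<open>D\<close> exists and is unique
  wherever the minors are nonzero, so the choice of branches is immaterial.
\<close>

definition PK_has_partial ::
    "nat \<Rightarrow> nat \<Rightarrow> complex mat \<Rightarrow> nat \<Rightarrow> nat \<Rightarrow> complex \<Rightarrow> bool" where
  "PK_has_partial k n M a b D \<longleftrightarrow>
     (\<exists>L. (\<forall>i<n. log_branch_at
               (\<lambda>t. PK_num k i (M |\<^sub>m (a, b) \<mapsto> t) / PK_den k i (M |\<^sub>m (a, b) \<mapsto> t))
               (M $$ (a, b)) (L i)) \<and>
          ((\<lambda>t. \<Sum>i<n. L i t) has_field_derivative D) (at (M $$ (a, b))))"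

definition PK_critical :: "nat \<Rightarrow> nat \<Rightarrow> complex mat \<Rightarrow> bool" where
  "PK_critical k n M \<longleftrightarrow>
     PK_minors_nonzero k n M \<and> (\<forall>a<k. \<forall>b<n. PK_has_partial k n M a b 0)"

definition X_mats :: "nat \<Rightarrow> nat \<Rightarrow> complex mat set" where
  "X_mats k n =
     {M \<in> carrier_mat k n. vec_space.rank k M = k \<and> (\<forall>j<n. col M j \<noteq> 0\<^sub>v k)}"

definition X_rel :: "nat \<Rightarrow> nat \<Rightarrow> complex mat rel" where
  "X_rel k n =
     {(M, N). M \<in> X_mats k n \<and> N \<in> X_mats k n \<and>
        (\<exists>g \<in> carrier_mat k k. \<exists>t \<in> carrier_mat n n.
           det g = 1 \<and> diagonal_mat t \<and> invertible_mat t \<and> N = g * M * t)}"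

definition Xbar :: "nat \<Rightarrow> nat \<Rightarrow> complex mat set set" where
  "Xbar k n = X_mats k n // X_rel k n"

text \<open>Being critical does not depend on the representative of the class.\<close>

definition PK_critical_points :: "nat \<Rightarrow> nat \<Rightarrow> complex mat set set" where
  "PK_critical_points k n = {C \<in> Xbar k n. \<exists>M\<in>C. PK_critical k n M}"

definition moebius :: "nat \<Rightarrow> int" where
  "moebius d = (if squarefree d then (- 1) ^ card (prime_factors d) else 0)"

definition PK_bound :: "nat \<Rightarrow> nat \<Rightarrow> real" where
  "PK_bound k n =
     1 / real n * (\<Sum>d | d dvd gcd k n. of_int (moebius d) * real ((n div d) choose (k div d)))"

text \<open>
  Binary strings are Boolean lists with \<open>False\<close> for 0 and \<open>True\<close> for 1. Strictness for
  every nontrivial shift also excludes the periodic strings.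
\<close>

definition lyndon_word :: "bool list \<Rightarrow> bool" where
  "lyndon_word w \<longleftrightarrow>
     (\<forall>m. 0 < m \<and> m < length w \<longrightarrow> (w, rotate m w) \<in> lexord {(False, True)})"

definition lyndon_words :: "nat \<Rightarrow> nat \<Rightarrow> bool list set" where
  "lyndon_words p q = {w. lyndon_word w \<and> count_list w True = p \<and> count_list w False = q}"

lemma log_branch_has_derivative:
  assumes "log_branch_at f z L" and "f z \<noteq> 0"
  shows "(L has_field_derivative deriv f z / f z) (at z)"
proof -
  obtain U where U: "open U" "z \<in> U" "L holomorphic_on U" "\<And>w. w \<in> U \<Longrightarrow> exp (L w) = f w"
    using assms(1) unfolding log_branch_at_def by blast
  have L: "(L has_field_derivative deriv L z) (at z)"
    using U holomorphic_derivI by blast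
  have "((\<lambda>w. exp (L w)) has_field_derivative exp (L z) * deriv L z) (at z)"
    using L by (auto intro!: derivative_eq_intros)
  then have "(f has_field_derivative f z * deriv L z) (at z)"
    using U by (metis (no_types, lifting) has_field_derivative_transform_within_open)
  then have "deriv f z = f z * deriv L z"
    by (rule DERIV_imp_deriv)
  then have "deriv L z = deriv f z / f z"
    using assms(2) by simp
  with L show ?thesis by simp
qed

lemma log_branch_exists:
  assumes "f holomorphic_on S" "open S" "z \<in> S" "f z \<noteq> 0"
  shows "\<exists>L. log_branch_at f z L"
proof -
  have "continuous_on S f"
    using assms(1) by (rule holomorphic_on_imp_continuous_on)
  then obtain e where e: "e > 0" "ball z e \<subseteq> S" "\<And>w. w \<in> ball z e \<Longrightarrow> f w \<noteq> 0"
  proof -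
    have "open (S \<inter> f -` (- {0}))"
      using \<open>continuous_on S f\<close> assms(2) by (rule continuous_open_preimage) auto
    moreover have "z \<in> S \<inter> f -` (- {0})" using assms by simp
    ultimately obtain e where "e > 0" "ball z e \<subseteq> S \<inter> f -` (- {0})"
      using open_contains_ball by blast
    then show ?thesis by (intro that[of e]) auto
  qed
  have "f holomorphic_on ball z e" using assms(1) e(2) by (rule holomorphic_on_subset)
  then obtain g where "g holomorphic_on ball z e" "\<And>w. w \<in> ball z e \<Longrightarrow> f w = exp (g w)"
    using contractible_imp_holomorphic_log[of f "ball z e"] e
    by (metis convex_ball convex_imp_contractible)
  then show ?thesis
    unfolding log_branch_at_def using e(1) by (intro exI[of _ g] exI[of _ "ball z e"]) auto
qed

lemma plucker_update_holomorphic: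
  assumes "M \<in> carrier_mat k n" "0 < n" "length cs = k"
  shows "(\<lambda>t. plucker cs (M |\<^sub>m (a, b) \<mapsto> t)) holomorphic_on UNIV"
proof -
  have entry: "(\<lambda>t. mat_of_cols (dim_row (M |\<^sub>m (a, b) \<mapsto> t))
        (map (\<lambda>c. col (M |\<^sub>m (a, b) \<mapsto> t) (c mod dim_col (M |\<^sub>m (a, b) \<mapsto> t))) cs) $$ (i, j))
        holomorphic_on UNIV" (is "?E holomorphic_on UNIV")
    if "i < k" "j < k" for i j
  proof -
    have "cs ! j mod n < n" using assms by simp
    then have "?E = (\<lambda>t. if (i, cs ! j mod n) = (a, b) then t else M $$ (i, cs ! j mod n))"
      using assms that by (auto simp: mat_of_cols_def update_mat_def fun_eq_iff)
    moreover have "(\<lambda>t. if (i, cs ! j mod n) = (a, b) then t else M $$ (i, cs ! j mod n))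
        holomorphic_on UNIV"
      by (cases "(i, cs ! j mod n) = (a, b)") (auto intro!: holomorphic_intros)
    ultimately show ?thesis by simp
  qed
  have "(\<lambda>t. plucker cs (M |\<^sub>m (a, b) \<mapsto> t)) =
      (\<lambda>t. \<Sum>p | p permutes {0..<k}. signof p * (\<Prod>i = 0..<k.
        mat_of_cols (dim_row (M |\<^sub>m (a, b) \<mapsto> t))
          (map (\<lambda>c. col (M |\<^sub>m (a, b) \<mapsto> t) (c mod dim_col (M |\<^sub>m (a, b) \<mapsto> t))) cs)
          $$ (i, p i)))"
    unfolding plucker_def det_def using assms by simp
  moreover have "\<dots> holomorphic_on UNIV"
    by (intro holomorphic_on_sum holomorphic_on_mult holomorphic_on_const holomorphic_on_prod entry)
      (auto dest: permutes_in_image)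
  ultimately show ?thesis by simp
qed

lemma PK_partial_ex1:
  assumes "M \<in> carrier_mat k n" "1 \<le> k" "a < k" "b < n" "PK_minors_nonzero k n M"
  shows "\<exists>!D. PK_has_partial k n M a b D"
proof -
  let ?f = "\<lambda>i t. PK_num k i (M |\<^sub>m (a, b) \<mapsto> t) / PK_den k i (M |\<^sub>m (a, b) \<mapsto> t)"
  let ?z = "M $$ (a, b)"
  have M: "M |\<^sub>m (a, b) \<mapsto> ?z = M"
    using assms by (intro eq_matI) (auto simp: update_mat_def)
  have num: "(\<lambda>t. PK_num k i (M |\<^sub>m (a, b) \<mapsto> t)) holomorphic_on UNIV" for i
    unfolding PK_num_def using assms by (intro plucker_update_holomorphic[of _ k n]) auto
  have den: "(\<lambda>t. PK_den k i (M |\<^sub>m (a, b) \<mapsto> t)) holomorphic_on UNIV" for i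
    unfolding PK_den_def using assms by (intro plucker_update_holomorphic[of _ k n]) auto
  have nz: "?f i ?z \<noteq> 0" if "i < n" for i
    using assms(5) that by (simp add: M PK_minors_nonzero_def)
  have ex: "\<exists>L. log_branch_at (?f i) ?z L" if "i < n" for i
  proof -
    let ?S = "(\<lambda>t. PK_den k i (M |\<^sub>m (a, b) \<mapsto> t)) -` (- {0})"
    have "open ?S"
      using holomorphic_on_imp_continuous_on[OF den] by (intro open_vimage) auto
    moreover have "?f i holomorphic_on ?S"
      using num den by (intro holomorphic_on_divide) (auto intro: holomorphic_on_subset)
    moreover have "?z \<in> ?S"
      using assms(5) that by (simp add: M PK_minors_nonzero_def)
    ultimately show ?thesis using nz[OF that] log_branch_exists by blast
  qed
  have der: "((\<lambda>t. \<Sum>i<n. L i t) has_field_derivative (\<Sum>i<n. deriv (?f i) ?z / ?f i ?z)) (at ?z)"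
    if "\<forall>i<n. log_branch_at (?f i) ?z (L i)" for L
    using that nz by (intro DERIV_sum log_branch_has_derivative) auto
  show ?thesis
  proof (rule ex1I)
    obtain L where "\<forall>i<n. log_branch_at (?f i) ?z (L i)"
      using ex by metis
    with der show "PK_has_partial k n M a b (\<Sum>i<n. deriv (?f i) ?z / ?f i ?z)"
      unfolding PK_has_partial_def by blast
  next
    fix D assume "PK_has_partial k n M a b D"
    then show "D = (\<Sum>i<n. deriv (?f i) ?z / ?f i ?z)"
      unfolding PK_has_partial_def using der DERIV_unique by blast
  qed
qed

end

theory Submission
  imports Defs "Jordan_Normal_Form.DL_Rank_Submatrix"
begin

text \<open>
  Write \<open>v j\<close> for column \<open>j mod n\<close> of a critical matrix. Its \<open>k\<close> consecutive columns
  starting at \<open>i\<close> form a basis. When one column of a minor moves, the logarithmic derivative of the minor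
  is a coordinate of the direction in which the column moves. Let \<open>r i t\<close> be the coefficients of
  \<open>v (i + k) = (\<Sum>t=1..k. r i t * v (i + k - t))\<close>, and let \<open>\<mu> i\<close> be the functional that
  vanishes on \<open>v i, \<dots>, v (i + k - 2)\<close> and is 1 on \<open>v (i + k)\<close>. Expressing denominators
  through numerators by a basis exchange, the critical equations for column \<open>m + k\<close> collapse to
  \<open>\<mu> m = (\<Sum>t=1..k. r (m + t) t * \<mu> (m + t))\<close> (\<open>critical_dual_recurrence\<close>): the same array
  \<open>r\<close> governs the columns and, read in the other direction, the dual functionals.

  Rescale the columns so that \<open>r i 1\<close> becomes a constant \<open>\<kappa>\<close>, which is possible cyclically when
  \<open>\<kappa> ^ n\<close> is the product of these coefficients. Evaluating \<open>\<mu> m\<close> on later columns by the one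
  recurrence and by the other then shows, one \<open>t\<close> after another, that \<open>r i t\<close> does not depend on
  \<open>i\<close> at all (\<open>two_sided_recurrence_constant\<close>).

  So the rescaled columns are an \<open>n\<close>-periodic solution of a recurrence with constant
  coefficients. By discrete Fourier analysis the matrix is, up to \<open>GL(k)\<close> and column scaling, the
  Vandermonde matrix of \<open>k\<close> distinct \<open>n\<close>-th roots of unity (\<open>recurrence_imp_vandermonde\<close>). The
  sum of these roots is \<open>\<kappa>\<close>, which is not zero, so the set of roots is not stable under any
  nontrivial rotation; and rotating the set only rescales columns (\<open>word_of_primitive\<close>,
  \<open>word_of_twist\<close>). Hence every critical class is given by a Lyndon word with \<open>k\<close> ones among the
  \<open>n\<close> exponents.

  The number of these words follows by Moebius inversion: primitive words fall into rotation
  classes of size \<open>n\<close> with one Lyndon word each, and the words with a given period are counted by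
  a binomial coefficient (\<open>PK_bound_eq_card_lyndon\<close>).
\<close>

section \<open>Lyndon words and Moebius inversion\<close>

text \<open>
  Only squarefree divisors contribute. For a prime \<open>p\<close> dividing \<open>e\<close> those prime to \<open>p\<close>
  are paired with their \<open>p\<close>-fold multiples, and the two values in a pair have opposite sign.
\<close>
lemma sum_moebius_divisors:
  assumes "e > 0"
  shows "(\<Sum>d | d dvd e. moebius d) = (if e = 1 then 1 else 0)"
proof (cases "e = 1")
  case True
  then show ?thesis by (simp add: moebius_def)
next
  case False
  then obtain p where p: "prime p" "p dvd e"
    using prime_factor_nat by blast
  define A where "A = {d. d dvd e \<and> squarefree d \<and> \<not> p dvd d}"
  have fin: "finite {d. d dvd e}" using assms by simp
  have finA: "finite A" by (rule finite_subset[OF _ fin]) (auto simp: A_def)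
  have cop: "coprime p d" if "d \<in> A" for d
    using that p(1) by (simp add: A_def prime_imp_coprime)
  have split: "{d. d dvd e \<and> squarefree d} = A \<union> (*) p ` A"
  proof (intro equalityI subsetI)
    fix d assume d: "d \<in> {d. d dvd e \<and> squarefree d}"
    show "d \<in> A \<union> (*) p ` A"
    proof (cases "p dvd d")
      case True
      then obtain c where c: "d = p * c" by blast
      have "squarefree (p * c)" "c dvd e" using d c by (auto dest: dvd_mult_right)
      moreover have "\<not> p dvd c"
      proof
        assume "p dvd c"
        then have "p ^ 2 dvd p * c" by (simp add: power2_eq_square mult_dvd_mono)
        then have "is_unit p" using \<open>squarefree (p * c)\<close> by (rule squarefreeD[rotated])
        then show False using p(1) by simp
      qed
      moreover have "squarefree c"
        using \<open>squarefree (p * c)\<close> by (rule squarefree_mono[rotated]) simp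
      ultimately show ?thesis using c by (auto simp: A_def)
    qed (use d in \<open>auto simp: A_def\<close>)
  next
    fix d assume "d \<in> A \<union> (*) p ` A"
    then show "d \<in> {d. d dvd e \<and> squarefree d}"
    proof
      assume "d \<in> (*) p ` A"
      then obtain c where c: "c \<in> A" "d = p * c" by blast
      then have "p * c dvd e" using cop[OF c(1)] p(2) by (simp add: A_def divides_mult)
      moreover have "squarefree (p * c)"
        using cop[OF c(1)] c(1) p(1) by (simp add: A_def squarefree_mult_coprime squarefree_prime)
      ultimately show ?thesis using c(2) by simp
    qed (simp add: A_def)
  qed
  have flip: "moebius (p * d) = - moebius d" if d: "d \<in> A" for d
  proof -
    have "d \<noteq> 0" using d assms by (auto simp: A_def)
    then have "prime_factors (p * d) = insert p (prime_factors d)"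
      using p(1) by (simp add: prime_factors_product prime_factorization_prime prime_gt_0_nat)
    moreover have "p \<notin> prime_factors d" using d by (auto simp: A_def)
    moreover have "squarefree (p * d)"
      using cop[OF d] d p(1) by (simp add: A_def squarefree_mult_coprime squarefree_prime)
    ultimately show ?thesis using d by (simp add: moebius_def A_def)
  qed
  have "(\<Sum>d | d dvd e. moebius d) = (\<Sum>d | d dvd e \<and> squarefree d. moebius d)"
    by (rule sum.mono_neutral_right[OF fin]) (auto simp: moebius_def)
  also have "\<dots> = (\<Sum>d\<in>A. moebius d) + (\<Sum>d\<in>(*) p ` A. moebius d)"
    unfolding split using finA by (intro sum.union_disjoint) (auto simp: A_def)
  also have "(\<Sum>d\<in>(*) p ` A. moebius d) = (\<Sum>d\<in>A. moebius (p * d))"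
    using p(1) by (subst sum.reindex) (auto simp: inj_on_def prime_gt_0_nat)
  also have "\<dots> = - (\<Sum>d\<in>A. moebius d)"
    by (simp add: flip sum_negf cong: sum.cong)
  finally show ?thesis using False by simp
qed

definition words :: "nat \<Rightarrow> nat \<Rightarrow> bool list set" where
  "words n k = {w. length w = n \<and> count_list w True = k}"

lemma finite_words: "finite (words n k)"
  by (rule finite_subset[OF _ finite_lists_length_eq[of UNIV n]]) (auto simp: words_def)

lemma count_True_False: "count_list w True + count_list w False = length w"
  by (induction w) auto

lemma card_words: "card (words n k) = n choose k"
proof (induction n arbitrary: k)
  case 0
  have "words 0 k = (if k = 0 then {[]} else {})" by (auto simp: words_def)
  then show ?case by simp
next
  case (Suc n)
  show ?case
  proof (cases k)
    case 0
    have "words (Suc n) 0 = (#) False ` words n 0"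
      by (auto simp: words_def length_Suc_conv split: if_splits)
    then show ?thesis using 0 Suc.IH[of 0] by (simp add: card_image)
  next
    case (Suc j)
    have eq: "words (Suc n) (Suc j) = (#) True ` words n j \<union> (#) False ` words n (Suc j)"
      by (auto simp: words_def length_Suc_conv split: if_splits)
    have "card (words (Suc n) (Suc j)) = card (words n j) + card (words n (Suc j))"
      unfolding eq by (subst card_Un_disjoint) (auto simp: finite_words card_image)
    then show ?thesis using Suc Suc.IH by simp
  qed
qed

lemma count_list_rotate: "count_list (rotate m w) x = count_list w x"
proof -
  have "count_list (rotate1 v) x = count_list v x" for v
    by (cases v) auto
  then show ?thesis by (induction m) auto
qed

text \<open>
  Commuting with \<open>x\<close> makes \<open>x\<close> a prefix of \<open>w\<close>; once it is split off, the rest still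
  commutes with \<open>x\<close>.
\<close>
lemma commuting_is_power:
  assumes "x @ w = w @ x" "length w = d * length x"
  shows "w = concat (replicate d x)"
  using assms
proof (induction d arbitrary: w)
  case 0
  then show ?case by simp
next
  case (Suc d)
  have "length x \<le> length w" using Suc.prems(2) by simp
  then have "take (length x) w = x"
    by (metis Suc.prems(1) append_eq_conv_conj take_append diff_is_0_eq take_0 append_Nil2)
  then obtain v where v: "w = x @ v" by (metis append_take_drop_id)
  then show ?case using Suc by simp
qed

lemma rotate_eq_imp_power:
  assumes "length w = d * m" "d > 0" "rotate m w = w"
  shows "w = concat (replicate d (take m w))"
proof -
  have m: "m \<le> length w" using assms by simp
  define x y where "x = take m w" and "y = drop m w"
  have w: "w = x @ y" and lx: "length x = m" using m by (auto simp: x_def y_def)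
  have "y @ x = x @ y" using assms(3) unfolding w lx[symmetric] by (simp add: rotate_append)
  then have "x @ w = w @ x" using w by simp
  then have "w = concat (replicate d x)"
    by (rule commuting_is_power) (simp add: assms(1) lx)
  then show ?thesis unfolding x_def .
qed

lemma count_list_power: "count_list (concat (replicate d u)) x = d * count_list u x"
  by (induction d) auto

lemma length_power: "length (concat (replicate d u)) = d * length u"
  by (induction d) auto

lemma rotate_power: "rotate (length u) (concat (replicate d u)) = concat (replicate d u)"
proof (cases d)
  case (Suc c)
  have "u @ concat (replicate c u) = concat (replicate c u) @ u"
    by (induction c) auto
  then show ?thesis
    using Suc rotate_append[of u "concat (replicate c u)"] by simp
qed simp

text \<open>
  A word fixed by rotation through \<open>n div d\<close> is a \<open>d\<close>-th power, hence determined by its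
  first \<open>n div d\<close> letters, which may be any word with \<open>k div d\<close> ones.
\<close>
lemma card_words_with_period:
  assumes "d > 0" "d dvd n" "d dvd k"
  shows "card {w \<in> words n k. rotate (n div d) w = w} = (n div d) choose (k div d)"
proof -
  obtain m j where mj: "n = d * m" "k = d * j" using assms by (auto elim!: dvdE)
  have "bij_betw (\<lambda>u. concat (replicate d u)) (words m j) {w \<in> words n k. rotate m w = w}"
  proof (rule bij_betwI[where g = "take m"])
    have power: "w = concat (replicate d (take m w))" if "w \<in> words n k" "rotate m w = w" for w
      using that(1) mj(1) assms(1) that(2) by (intro rotate_eq_imp_power) (simp_all add: words_def)
    show "(\<lambda>u. concat (replicate d u)) \<in> words m j \<rightarrow> {w \<in> words n k. rotate m w = w}"
    proof
      fix u assume "u \<in> words m j"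
      then show "concat (replicate d u) \<in> {w \<in> words n k. rotate m w = w}"
        using rotate_power[of u d] mj by (simp add: words_def count_list_power length_power)
    qed
    show "take m \<in> {w \<in> words n k. rotate m w = w} \<rightarrow> words m j"
    proof
      fix w assume w: "w \<in> {w \<in> words n k. rotate m w = w}"
      have "count_list w True = d * count_list (take m w) True"
        using arg_cong[OF power, of w "\<lambda>v. count_list v True"] w by (simp add: count_list_power)
      then show "take m w \<in> words m j" using w mj assms(1) by (simp add: words_def)
    qed
    show "take m (concat (replicate d u)) = u" if "u \<in> words m j" for u
      using that assms(1) by (cases d) (simp_all add: words_def)
    show "concat (replicate d (take m w)) = w" if "w \<in> {w \<in> words n k. rotate m w = w}" for w
      using power[of w] that by simp
  qed
  from bij_betw_same_card[OF this] show ?thesis using mj assms(1) by (simp add: card_words)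
qed

definition primitive :: "bool list \<Rightarrow> bool" where
  "primitive w \<longleftrightarrow> (\<forall>m. 0 < m \<and> m < length w \<longrightarrow> rotate m w \<noteq> w)"

text \<open>
  The rotations fixing a word form a semigroup closed under remainders, so they are the
  multiples of the least positive one.
\<close>
lemma minimal_period:
  assumes "w \<noteq> []"
  obtains m where "m > 0" "\<And>l. rotate l w = w \<longleftrightarrow> m dvd l"
proof -
  define m where "m = (LEAST m. 0 < m \<and> rotate m w = w)"
  have "0 < length w \<and> rotate (length w) w = w" using assms by simp
  then have m: "0 < m \<and> rotate m w = w" unfolding m_def by (rule LeastI)
  have mult: "rotate (c * m) w = w" for c
  proof (induction c)
    case (Suc c)
    have "rotate (Suc c * m) w = rotate m (rotate (c * m) w)" by (simp add: rotate_rotate)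
    then show ?case using Suc m by simp
  qed simp
  have "m dvd l" if l: "rotate l w = w" for l
  proof -
    have "rotate (l mod m) w = rotate (l mod m) (rotate (l div m * m) w)"
      by (simp add: mult)
    also have "\<dots> = w" by (simp add: rotate_rotate l)
    finally have "\<not> 0 < l mod m"
      using m not_less_Least[of "l mod m" "\<lambda>m. 0 < m \<and> rotate m w = w", folded m_def] by simp
    then show ?thesis by (simp add: dvd_eq_mod_eq_0)
  qed
  moreover have "rotate l w = w" if "m dvd l" for l
    using that mult by (auto elim!: dvdE simp: mult.commute)
  ultimately show thesis using that[of m] m by blast
qed

text \<open>
  If \<open>m\<close> is the minimal period and \<open>n = m * e\<close>, the divisors \<open>d\<close> that occur are those of
  \<open>e\<close>; they divide \<open>k\<close> automatically, since then the word is a \<open>d\<close>-th power. So the sum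
  detects \<open>e = 1\<close>.
\<close>
lemma moebius_sum_over_periods:
  assumes "w \<in> words n k" "n > 0"
  shows "(\<Sum>d | d dvd gcd k n \<and> rotate (n div d) w = w. moebius d) = (if primitive w then 1 else 0)"
proof -
  have w: "length w = n" "count_list w True = k" using assms(1) by (auto simp: words_def)
  with assms(2) have "w \<noteq> []" by auto
  then obtain m where m: "m > 0" "\<And>l. rotate l w = w \<longleftrightarrow> m dvd l"
    using minimal_period by blast
  have "m dvd n" using m(2)[of n] w by simp
  then obtain e where e: "n = m * e" by blast
  have e0: "e > 0" using e assms(2) by (cases e) auto
  have "{d. d dvd gcd k n \<and> rotate (n div d) w = w} = {d. d dvd e}"
  proof (intro equalityI subsetI)
    fix d assume "d \<in> {d. d dvd gcd k n \<and> rotate (n div d) w = w}"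
    then have d: "d dvd n" "m dvd n div d" using m(2) by auto
    then have "m * d dvd m * e" using e assms(2)
      by (metis dvd_div_mult_self mult_dvd_mono dvd_refl)
    then show "d \<in> {d. d dvd e}" using m(1) by simp
  next
    fix d assume "d \<in> {d. d dvd e}"
    then obtain c where c: "e = d * c" by blast
    then have d0: "d > 0" using e0 by simp
    have nd: "n = d * (m * c)" using c e by simp
    then have ndd: "n div d = m * c" using d0 by simp
    have rot: "rotate (m * c) w = w" using m(2) by simp
    have "w = concat (replicate d (take (m * c) w))"
      using rotate_eq_imp_power[OF _ d0 rot] w nd by simp
    then have "k = d * count_list (take (m * c) w) True" by (metis count_list_power w(2))
    then show "d \<in> {d. d dvd gcd k n \<and> rotate (n div d) w = w}"
      using nd ndd rot by simp
  qed
  moreover have "e = 1 \<longleftrightarrow> primitive w"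
  proof
    assume "e = 1"
    then show "primitive w" using e w m(2) unfolding primitive_def by (auto dest: dvd_imp_le)
  next
    assume p: "primitive w"
    have "m \<ge> n" using p m(1) m(2)[of m] w unfolding primitive_def by force
    then show "e = 1" using e e0 m(1) by (cases e) auto
  qed
  ultimately show ?thesis using sum_moebius_divisors[OF e0] by simp
qed

lemma card_primitive_words:
  assumes "n > 0"
  shows "int (card {w \<in> words n k. primitive w})
    = (\<Sum>d | d dvd gcd k n. moebius d * int ((n div d) choose (k div d)))"
proof -
  let ?D = "{d. d dvd gcd k n}"
  have fin: "finite ?D" using assms by simp
  have "int (card {w \<in> words n k. primitive w}) = (\<Sum>w\<in>words n k. if primitive w then 1 else 0)"
    by (simp add: finite_words sum.If_cases Int_def)
  also have "\<dots> = (\<Sum>w\<in>words n k. \<Sum>d | d \<in> ?D \<and> rotate (n div d) w = w. moebius d)"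
    by (intro sum.cong refl) (simp only: mem_Collect_eq moebius_sum_over_periods[OF _ assms])
  also have "\<dots> = (\<Sum>d\<in>?D. \<Sum>w | w \<in> words n k \<and> rotate (n div d) w = w. moebius d)"
    using fin finite_words by (rule sum.swap_restrict[rotated])
  also have "\<dots> = (\<Sum>d\<in>?D. moebius d * int ((n div d) choose (k div d)))"
  proof (intro sum.cong refl)
    fix d assume "d \<in> ?D"
    then have "d dvd n" "d dvd k" by auto
    moreover from this assms have "d > 0" by (auto intro: Nat.gr0I)
    ultimately show "(\<Sum>w | w \<in> words n k \<and> rotate (n div d) w = w. moebius d)
        = moebius d * int ((n div d) choose (k div d))"
      using card_words_with_period[of d n k] by simp
  qed
  finally show ?thesis by simp
qed

text \<open>
  A rotation that is minimal for the well-founded order \<open>lex\<close> is weakly below all its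
  rotations by totality, and strictly so because the word is primitive.
\<close>
lemma lyndon_rotation_exists:
  assumes "primitive w" "w \<noteq> []"
  shows "\<exists>m < length w. lyndon_word (rotate m w)"
proof -
  let ?r = "{(False, True)}"
  let ?Q = "{rotate m w |m. m < length w}"
  have "wf ?r" by (rule wf_subset[OF wf_inv_image[OF wf_less_than, of of_bool]]) (auto simp: inv_image_def)
  then have "wf (lex ?r)" by (rule wf_lex)
  moreover have "rotate 0 w \<in> ?Q" using assms(2) by (auto intro!: exI[of _ 0])
  ultimately obtain v where v: "v \<in> ?Q" "\<And>u. (u, v) \<in> lex ?r \<Longrightarrow> u \<notin> ?Q"
    by (rule wfE_min) blast
  then obtain m where m: "m < length w" "v = rotate m w" by blast
  have "(v, rotate l v) \<in> lexord ?r" if l: "0 < l" "l < length v" for l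
  proof -
    have in_Q: "rotate l v \<in> ?Q"
    proof -
      have "rotate l v = rotate ((l + m) mod length w) w"
        using m(2) rotate_conv_mod[of "l + m" w] by (simp only: rotate_rotate)
      then show ?thesis using assms(2) by auto
    qed
    have "(rotate l v, v) \<notin> lexord ?r"
    proof
      assume "(rotate l v, v) \<in> lexord ?r"
      then have "(rotate l v, v) \<in> lex ?r" by (simp add: lexord_lex)
      then show False using v(2) in_Q by blast
    qed
    moreover have "rotate l v \<noteq> v"
    proof
      assume "rotate l v = v"
      then have "rotate m (rotate l w) = rotate m w" using m(2) by (simp add: rotate_rotate add.commute)
      moreover have "inj (rotate m :: bool list \<Rightarrow> _)"
        unfolding rotate_def by (rule inj_fn[OF inj_rotate1])
      ultimately have "rotate l w = w" by (simp add: inj_eq)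
      then show False using assms(1) l m(2) by (simp add: primitive_def)
    qed
    ultimately show ?thesis using lexord_linear[of ?r v "rotate l v"] by auto
  qed
  then show ?thesis using m unfolding lyndon_word_def by auto
qed

lemma lyndon_word_primitive: "lyndon_word w \<Longrightarrow> primitive w"
  unfolding lyndon_word_def primitive_def by (metis lexord_irreflexive prod.inject singletonD)

lemma lyndon_words_altdef:
  assumes "k \<le> n"
  shows "lyndon_words k (n - k) = {w \<in> words n k. lyndon_word w}"
proof -
  have "length w = n \<longleftrightarrow> count_list w False = n - k" if "count_list w True = k" for w
    using count_True_False[of w] that assms by linarith
  then show ?thesis by (auto simp: lyndon_words_def words_def)
qed

lemma rotate_words_iff: "rotate m w \<in> words n k \<longleftrightarrow> w \<in> words n k"
  by (simp add: words_def count_list_rotate)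

lemma primitive_rotate: "primitive w \<Longrightarrow> primitive (rotate m w)"
proof -
  assume p: "primitive w"
  have "inj (rotate m :: bool list \<Rightarrow> _)" unfolding rotate_def by (rule inj_fn[OF inj_rotate1])
  then have "rotate l (rotate m w) = rotate m w \<longleftrightarrow> rotate l w = w" for l
    by (metis add.commute injD rotate_rotate)
  then show ?thesis using p by (simp add: primitive_def)
qed

text \<open>
  Every primitive word arises exactly once by rotating a Lyndon word through \<open>m < n\<close>: two
  Lyndon words in one rotation class would each be smaller than the other.
\<close>
lemma card_primitive_eq_lyndon:
  assumes "k \<le> n" "n > 0"
  shows "card {w \<in> words n k. primitive w} = n * card (lyndon_words k (n - k))"
proof -
  let ?L = "lyndon_words k (n - k)" and ?r = "{(False, True)}"
  note L = lyndon_words_altdef[OF assms(1)]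
  have "bij_betw (\<lambda>(m, w). rotate m w) ({..<n} \<times> ?L) {w \<in> words n k. primitive w}"
    unfolding bij_betw_def
  proof
    have aux: "w = w' \<and> m = m'" if "rotate m w = rotate m' w'" "m \<le> m'" "m' < n"
      "w \<in> ?L" "w' \<in> ?L" for m m' w w'
    proof -
      have len: "length w = n" "length w' = n" and ly: "lyndon_word w" "lyndon_word w'"
        using that L by (auto simp: words_def)
      have "inj (rotate m :: bool list \<Rightarrow> _)" unfolding rotate_def by (rule inj_fn[OF inj_rotate1])
      moreover have "rotate m' w' = rotate m (rotate (m' - m) w')"
        using that(2) by (simp add: rotate_rotate)
      ultimately have eq: "w = rotate (m' - m) w'" using that(1) by (metis injD)
      show ?thesis
      proof (cases "m = m'")
        case False
        define l where "l = m' - m"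
        have l: "0 < l" "l < n" using False that by (auto simp: l_def)
        have "rotate (n - l) w = w'"
          using eq l len by (simp add: l_def[symmetric] rotate_rotate)
        then have "(w, w') \<in> lexord ?r" "(w', w) \<in> lexord ?r"
          using ly(1)[unfolded lyndon_word_def, rule_format, of "n - l"]
            ly(2)[unfolded lyndon_word_def, rule_format, of l] l len eq
          by (simp_all add: l_def)
        then show ?thesis
          using lexord_asymmetric[of ?r w w'] asymI[of ?r] by blast
      qed (use eq in simp)
    qed
    show "inj_on (\<lambda>(m, w). rotate m w) ({..<n} \<times> ?L)"
    proof (rule inj_onI, clarify)
      fix m w m' w'
      assume "m < n" "m' < n" "w \<in> ?L" "w' \<in> ?L" "rotate m w = rotate m' w'"
      then show "m = m' \<and> w = w'"
        using aux[of m w m' w'] aux[of m' w' m w] by (metis nat_le_linear)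
    qed
    show "(\<lambda>(m, w). rotate m w) ` ({..<n} \<times> ?L) = {w \<in> words n k. primitive w}"
    proof (intro equalityI subsetI)
      fix v assume "v \<in> (\<lambda>(m, w). rotate m w) ` ({..<n} \<times> ?L)"
      then obtain m w where v: "v = rotate m w" and w: "w \<in> ?L" by auto
      then have "w \<in> words n k" "primitive w" by (simp_all add: L lyndon_word_primitive)
      then show "v \<in> {w \<in> words n k. primitive w}"
        by (simp add: v rotate_words_iff primitive_rotate)
    next
      fix v assume v: "v \<in> {w \<in> words n k. primitive w}"
      then have len: "length v = n" and ne: "v \<noteq> []" using assms(2) by (auto simp: words_def)
      obtain m where m: "m < n" "lyndon_word (rotate m v)"
        using lyndon_rotation_exists[of v] v ne len by auto
      define l where "l = (n - m) mod n"
      have "rotate l (rotate m v) = rotate (n - m) (rotate m v)"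
        using rotate_conv_mod[of "n - m" "rotate m v"] len by (simp only: l_def length_rotate)
      also have "\<dots> = v" using m(1) len by (simp add: rotate_rotate)
      finally have "rotate l (rotate m v) = v" .
      moreover have "rotate m v \<in> ?L" using m(2) v L by (simp add: rotate_words_iff)
      moreover have "l < n" using assms(2) by (simp add: l_def)
      ultimately show "v \<in> (\<lambda>(m, w). rotate m w) ` ({..<n} \<times> ?L)"
        by (auto intro!: image_eqI[of _ _ "(l, rotate m v)"])
    qed
  qed
  from bij_betw_same_card[OF this] show ?thesis by (simp add: card_cartesian_product)
qed

theorem PK_bound_eq_card_lyndon:
  assumes "k \<le> n" "n > 0"
  shows "PK_bound k n = real (card (lyndon_words k (n - k)))"
proof -
  have "(\<Sum>d | d dvd gcd k n. of_int (moebius d) * real ((n div d) choose (k div d)))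
      = real_of_int (int (card {w \<in> words n k. primitive w}))"
    unfolding card_primitive_words[OF assms(2)] by simp
  also have "\<dots> = real n * real (card (lyndon_words k (n - k)))"
    by (simp add: card_primitive_eq_lyndon[OF assms])
  finally show ?thesis using assms(2) by (simp add: PK_bound_def)
qed

section \<open>Sums and two-sided recurrences\<close>

lemma (in comm_monoid_set) shift_periodic:
  assumes "\<And>i::nat. g (i + n) = g i"
  shows "F (\<lambda>l. g (l + c)) {..<n} = F g {..<n}"
proof (induction c)
  case (Suc c)
  have "F (\<lambda>l. g (l + Suc c)) {..<n} = F (\<lambda>l. g (l + c)) {..<n}"
  proof (cases n)
    case (Suc m)
    have "F (\<lambda>l. g (l + Suc c)) {..<Suc m} = f (F (\<lambda>l. g (Suc l + c)) {..<m}) (g (0 + c))"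
      using assms[of c] Suc by (simp add: lessThan_Suc ac_simps)
    also have "\<dots> = F (\<lambda>l. g (l + c)) {..<Suc m}"
      unfolding lessThan_Suc_shift by (simp add: ac_simps)
    finally show ?thesis using Suc by simp
  qed simp
  then show ?case using Suc by simp
qed simp

lemma sum_reflect:
  fixes f :: "nat \<Rightarrow> 'a::comm_monoid_add"
  shows "(\<Sum>l<k. f (k - l)) = (\<Sum>t=1..k. f t)"
  by (rule sum.reindex_bij_witness[where i = "\<lambda>t. k - t" and j = "\<lambda>l. k - l"]) auto

lemma sum_restrict_le:
  fixes f :: "nat \<Rightarrow> 'a::comm_monoid_add"
  assumes "s \<le> k" "\<And>t. s < t \<Longrightarrow> t \<le> k \<Longrightarrow> f t = 0"
  shows "(\<Sum>t=1..k. f t) = (\<Sum>t=1..s. f t)"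
  using assms by (intro sum.mono_neutral_right) auto

text \<open>
  Both recurrences express \<open>F m s\<close> through values with smaller second argument, and the only
  terms that involve the new coefficient are \<open>R (m + s - 1) s\<close> on one side and \<open>R (m + s) s\<close>
  on the other, each multiplied by \<open>F _ 0 = 1\<close>. All remaining terms agree by induction, so the
  difference of the two recurrences is \<open>R (m + s - 1) s = R (m + s) s\<close>. As \<open>m\<close> ranges over the
  natural numbers this only reaches indices from \<open>s - 1\<close> on, whence the offset.
\<close>
lemma two_sided_recurrence_constant:
  fixes R F :: "nat \<Rightarrow> nat \<Rightarrow> 'a::comm_ring_1"
  assumes F0: "\<And>m. F m 0 = 1"
    and right: "\<And>m s. 1 \<le> s \<Longrightarrow> s \<le> k \<Longrightarrow> F m s = (\<Sum>t=1..s. R (m + s - 1) t * F m (s - t))"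
    and left: "\<And>m s. 1 \<le> s \<Longrightarrow> s \<le> k \<Longrightarrow> F m s = (\<Sum>t=1..s. R (m + t) t * F (m + t) (s - t))"
  shows "s \<le> k \<Longrightarrow> (\<forall>m. F m s = F 0 s) \<and> (1 \<le> s \<longrightarrow> (\<forall>i. R (i + (s - 1)) s = R (s - 1) s))"
proof (induction s rule: less_induct)
  case (less s)
  show ?case
  proof (cases "s = 0")
    case True
    then show ?thesis by (simp add: F0)
  next
    case False
    then have s: "1 \<le> s" by simp
    have IH: "(\<forall>m. F m t = F 0 t) \<and> (1 \<le> t \<longrightarrow> (\<forall>i. R (i + (t - 1)) t = R (t - 1) t))"
      if "t < s" for t
      by (rule less.IH[OF that]) (use that less.prems in linarith)
    have IHF: "F m t = F 0 t" if "t < s" for m t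
      using IH[OF that] by blast
    have IHR: "R i t = R (t - 1) t" if "1 \<le> t" "t < s" "t - 1 \<le> i" for i t
    proof -
      have "\<forall>j. R (j + (t - 1)) t = R (t - 1) t" using IH[OF that(2)] that(1) by blast
      from this[rule_format, of "i - (t - 1)"] show ?thesis using that(3) by simp
    qed
    define S where "S = (\<Sum>t=1..<s. R (t - 1) t * F 0 (s - t))"
    have R1: "F m s = R (m + s - 1) s + S" for m
    proof -
      have "F m s = (\<Sum>t=1..<s. R (m + s - 1) t * F m (s - t)) + R (m + s - 1) s"
        using right[OF s less.prems, of m] s F0[of m]
        by (simp add: sum.last_plus algebra_simps flip: atLeastLessThanSuc_atLeastAtMost)
      also have "(\<Sum>t=1..<s. R (m + s - 1) t * F m (s - t)) = S"
        unfolding S_def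
      proof (intro sum.cong refl)
        fix t assume t: "t \<in> {1..<s}"
        show "R (m + s - 1) t * F m (s - t) = R (t - 1) t * F 0 (s - t)"
          using IHR[of t "m + s - 1"] IHF[of "s - t" m] t by auto
      qed
      finally show ?thesis by (simp add: add.commute)
    qed
    have R2: "F m s = R (m + s) s + S" for m
    proof -
      have "F m s = (\<Sum>t=1..<s. R (m + t) t * F (m + t) (s - t)) + R (m + s) s"
        using left[OF s less.prems, of m] s F0[of "m + s"]
        by (simp add: sum.last_plus algebra_simps flip: atLeastLessThanSuc_atLeastAtMost)
      also have "(\<Sum>t=1..<s. R (m + t) t * F (m + t) (s - t)) = S"
        unfolding S_def
      proof (intro sum.cong refl)
        fix t assume t: "t \<in> {1..<s}"
        show "R (m + t) t * F (m + t) (s - t) = R (t - 1) t * F 0 (s - t)"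
          using IHR[of t "m + t"] IHF[of "s - t" "m + t"] t by auto
      qed
      finally show ?thesis by (simp add: add.commute)
    qed
    have const: "R (i + (s - 1)) s = R (s - 1) s" for i
    proof (induction i)
      case (Suc i)
      have "R (Suc i + (s - 1)) s = R (i + (s - 1)) s"
        using R1[of i] R2[of i] s by simp
      then show ?case using Suc by simp
    qed simp
    have "F m s = F 0 s" for m
      using R1[of m] R1[of 0] const[of m] s by simp
    then show ?thesis using const by blast
  qed
qed

section \<open>Coordinates and derivatives of minors\<close>

text \<open>
  By Cramer's rule this is the \<open>j\<close>-th coordinate of \<open>w\<close> in the basis of columns of \<open>A\<close>. The
  cofactor form is also the logarithmic derivative of \<open>det A\<close> when column \<open>j\<close> moves in
  direction \<open>w\<close>, which is how it enters the critical equations.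
\<close>
definition coord :: "complex mat \<Rightarrow> nat \<Rightarrow> complex vec \<Rightarrow> complex" where
  "coord A j w = (\<Sum>a<dim_row A. cofactor A a j * w $ a) / det A"

lemma coord_col:
  assumes "A \<in> carrier_mat k k" "det A \<noteq> 0" "j < k" "l < k"
  shows "coord A j (col A l) = (if j = l then 1 else 0)"
proof -
  have "(adj_mat A * A) $$ (j, l) = (det A \<cdot>\<^sub>m 1\<^sub>m k) $$ (j, l)"
    using adj_mat(3)[OF assms(1)] by simp
  then have "(\<Sum>a<k. cofactor A a j * A $$ (a, l)) = (if j = l then det A else 0)"
    using assms by (simp add: adj_mat_def scalar_prod_def atLeast0LessThan)
  then show ?thesis using assms by (simp add: coord_def)
qed

lemma coord_expand:
  fixes w :: "complex vec"
  assumes "A \<in> carrier_mat k k" "det A \<noteq> 0" "a < k"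
  shows "w $ a = (\<Sum>j<k. coord A j w * A $$ (a, j))"
proof -
  have "(\<Sum>j<k. A $$ (a, j) * cofactor A c j) = (if a = c then det A else 0)" if "c < k" for c
  proof -
    have "(A * adj_mat A) $$ (a, c) = (det A \<cdot>\<^sub>m 1\<^sub>m k) $$ (a, c)"
      using adj_mat(2)[OF assms(1)] by simp
    then show ?thesis
      using assms that by (simp add: adj_mat_def scalar_prod_def atLeast0LessThan)
  qed
  note inv = this
  have "(\<Sum>j<k. coord A j w * A $$ (a, j))
      = (\<Sum>j<k. \<Sum>c<k. A $$ (a, j) * cofactor A c j * w $ c / det A)"
    using assms(1)
    by (simp add: coord_def sum_distrib_left sum_distrib_right sum_divide_distrib mult_ac)
  also have "\<dots> = (\<Sum>c<k. (\<Sum>j<k. A $$ (a, j) * cofactor A c j) * w $ c / det A)"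
    by (subst sum.swap) (simp add: sum_distrib_right sum_divide_distrib)
  also have "\<dots> = (\<Sum>c<k. if a = c then w $ a else 0)"
    using assms(2) by (intro sum.cong refl) (simp add: inv)
  also have "\<dots> = w $ a" using assms(3) by simp
  finally show ?thesis by simp
qed

lemma coord_linear:
  fixes w :: "complex vec" and B :: "nat \<Rightarrow> complex vec"
  assumes "\<And>a. a < dim_row A \<Longrightarrow> w $ a = (\<Sum>l\<in>I. c l * B l $ a)"
  shows "coord A j w = (\<Sum>l\<in>I. c l * coord A j (B l))"
proof -
  have "(\<Sum>a<dim_row A. cofactor A a j * w $ a)
      = (\<Sum>a<dim_row A. \<Sum>l\<in>I. c l * (cofactor A a j * B l $ a))"
    using assms by (simp add: sum_distrib_left mult_ac)
  also have "\<dots> = (\<Sum>l\<in>I. c l * (\<Sum>a<dim_row A. cofactor A a j * B l $ a))"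
    by (subst sum.swap) (simp add: sum_distrib_left)
  finally show ?thesis by (simp add: coord_def flip: sum_divide_distrib)
qed

text \<open>
  When one basis vector \<open>col A p\<close> is exchanged for \<open>col C p\<close>, its coefficient in the
  expansion of \<open>col C p\<close> cannot vanish, and all coordinates change by a multiple of the last one.
  This rewrites the derivatives of the denominators in terms of those of the numerators.
\<close>
lemma coord_exchange:
  assumes A: "A \<in> carrier_mat (Suc p) (Suc p)" "det A \<noteq> 0"
    and C: "C \<in> carrier_mat (Suc p) (Suc p)" "det C \<noteq> 0"
    and agree: "\<And>l. l < p \<Longrightarrow> col C l = col A l"
  shows "coord A p (col C p) \<noteq> 0"
    and "coord C p w = coord A p w / coord A p (col C p)"
    and "j < p \<Longrightarrow> coord C j w = coord A j w
          - coord A j (col C p) * (coord A p w / coord A p (col C p))"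
proof -
  have expand: "coord A j w = (if j < p then coord C j w else 0) + coord C p w * coord A j (col C p)"
    if "j < Suc p" for j w
  proof -
    have "coord A j w = (\<Sum>l<Suc p. coord C l w * coord A j (col C l))"
    proof (rule coord_linear)
      fix a assume "a < dim_row A"
      then show "w $ a = (\<Sum>l<Suc p. coord C l w * col C l $ a)"
        using coord_expand[OF C, of a w] A(1) C(1) by (simp del: sum.lessThan_Suc)
    qed
    also have "\<dots> = (\<Sum>l<p. coord C l w * (if j = l then 1 else 0)) + coord C p w * coord A j (col C p)"
      using agree that A by (simp add: coord_col)
    also have "(\<Sum>l<p. coord C l w * (if j = l then 1 else 0)) = (if j < p then coord C j w else 0)"
      by (simp add: if_distrib sum.delta cong: if_cong)
    finally show ?thesis .
  qed
  have "1 = coord C p (col A p) * coord A p (col C p)"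
    using expand[of p "col A p"] coord_col[OF A, of p p] by simp
  then show nz: "coord A p (col C p) \<noteq> 0" by auto
  show last: "coord C p w = coord A p w / coord A p (col C p)"
    using expand[of p w] nz by simp
  show "coord C j w = coord A j w - coord A j (col C p) * (coord A p w / coord A p (col C p))"
    if "j < p"
    using expand[of j w] that last by simp
qed

text \<open>
  Laplace expansion along the column of the moving entry: no cofactor of that column
  involves the entry.
\<close>
lemma plucker_update:
  assumes M: "M \<in> carrier_mat k n" and ab: "a < k" "b < n" and cs: "length cs = k" and l: "l < k"
    and only: "\<And>j. j < k \<Longrightarrow> cs ! j mod n = b \<longleftrightarrow> j = l"
  shows "plucker cs (M |\<^sub>m (a, b) \<mapsto> t) = plucker cs M
    + (t - M $$ (a, b)) * cofactor (mat_of_cols k (map (\<lambda>c. col M (c mod n)) cs)) a l"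
proof -
  let ?A = "mat_of_cols k (map (\<lambda>c. col M (c mod n)) cs)"
  let ?B = "mat_of_cols k (map (\<lambda>c. col (M |\<^sub>m (a, b) \<mapsto> t) (c mod n)) cs)"
  have n: "n > 0" using ab by simp
  have A: "?A \<in> carrier_mat k k" and B: "?B \<in> carrier_mat k k" using cs by auto
  have ent: "?B $$ (i, j) = (if i = a \<and> j = l then t else ?A $$ (i, j))" if "i < k" "j < k" for i j
    using that M cs n only[of j] by (auto simp: mat_of_cols_index)
  have cof: "cofactor ?B i l = cofactor ?A i l" if "i < k" for i
  proof -
    have "mat_delete ?B i l = mat_delete ?A i l"
    proof (rule eq_matI)
      fix x y assume "x < dim_row (mat_delete ?A i l)" "y < dim_col (mat_delete ?A i l)"
      then have xy: "x < k - 1" "y < k - 1" using A by auto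
      define x' y' where "x' = (if x < i then x else Suc x)" and "y' = (if y < l then y else Suc y)"
      have "x' < k" "y' < k" "y' \<noteq> l" using xy by (auto simp: x'_def y'_def)
      then show "mat_delete ?B i l $$ (x, y) = mat_delete ?A i l $$ (x, y)"
        using xy cs ent[of x' y'] by (simp add: mat_delete_def flip: x'_def y'_def)
    qed (use A B in auto)
    then show ?thesis by (simp add: cofactor_def)
  qed
  have Al: "?A $$ (a, l) = M $$ (a, b)"
    using M cs n ab l only[of l] by (auto simp: mat_of_cols_index)
  have "det ?B = (\<Sum>i<k. ?B $$ (i, l) * cofactor ?B i l)"
    by (rule laplace_expansion_column[OF B l])
  also have "\<dots> = (\<Sum>i<k. ?A $$ (i, l) * cofactor ?A i l
      + (if i = a then (t - M $$ (a, b)) * cofactor ?A a l else 0))"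
    using l by (intro sum.cong refl) (auto simp: ent cof Al algebra_simps)
  also have "\<dots> = det ?A + (t - M $$ (a, b)) * cofactor ?A a l"
    using ab laplace_expansion_column[OF A l] by (simp add: sum.distrib)
  finally show ?thesis using M by (simp add: plucker_def)
qed

lemma plucker_update_other:
  assumes M: "M \<in> carrier_mat k n" and ab: "a < k" "b < n" and cs: "length cs = k"
    and none: "\<And>j. j < k \<Longrightarrow> cs ! j mod n \<noteq> b"
  shows "plucker cs (M |\<^sub>m (a, b) \<mapsto> t) = plucker cs M"
proof -
  have n: "n > 0" using ab by simp
  have "mat_of_cols k (map (\<lambda>c. col (M |\<^sub>m (a, b) \<mapsto> t) (c mod n)) cs)
      = mat_of_cols k (map (\<lambda>c. col M (c mod n)) cs)"
    using M cs n none by (intro eq_matI) (auto simp: mat_of_cols_index)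
  then show ?thesis using M by (simp add: plucker_def)
qed

definition minor_mat :: "nat \<Rightarrow> complex mat \<Rightarrow> nat list \<Rightarrow> complex mat" where
  "minor_mat k M cs = mat_of_cols k (map (\<lambda>c. col M (c mod dim_col M)) cs)"

lemma plucker_log_derivative:
  assumes M: "M \<in> carrier_mat k n" and ab: "a < k" "b < n" and cs: "length cs = k"
    and inj: "\<And>i j. i < k \<Longrightarrow> j < k \<Longrightarrow> cs ! i mod n = cs ! j mod n \<Longrightarrow> i = j"
    and nz: "plucker cs M \<noteq> 0"
  shows "((\<lambda>t. plucker cs (M |\<^sub>m (a, b) \<mapsto> t)) has_field_derivative
    plucker cs M * (\<Sum>l<k. if cs ! l mod n = b then coord (minor_mat k M cs) l (unit_vec k a) else 0))
    (at (M $$ (a, b)))"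
proof (cases "\<exists>l<k. cs ! l mod n = b")
  case True
  then obtain l where l: "l < k" "cs ! l mod n = b" by blast
  have only: "cs ! j mod n = b \<longleftrightarrow> j = l" if "j < k" for j
    using inj[of j l] that l by auto
  let ?A = "minor_mat k M cs"
  have det: "det ?A = plucker cs M" and A: "?A \<in> carrier_mat k k"
    using M cs by (auto simp: plucker_def minor_mat_def)
  have "(\<Sum>j<k. if cs ! j mod n = b then coord ?A j (unit_vec k a) else 0)
      = (\<Sum>j<k. if j = l then coord ?A l (unit_vec k a) else 0)"
    by (intro sum.cong refl) (auto simp: only)
  also have "\<dots> = cofactor ?A a l / plucker cs M"
    using l(1) A ab(1) by (simp add: coord_def det if_distrib sum.delta cong: if_cong)
  finally have sum: "(\<Sum>j<k. if cs ! j mod n = b then coord ?A j (unit_vec k a) else 0)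
      = cofactor ?A a l / plucker cs M" .
  have "(\<lambda>t. plucker cs (M |\<^sub>m (a, b) \<mapsto> t)) = (\<lambda>t. plucker cs M + (t - M $$ (a, b)) * cofactor ?A a l)"
    using plucker_update[OF M ab cs l(1) only] M by (auto simp: minor_mat_def)
  then show ?thesis unfolding sum using nz by (auto intro!: derivative_eq_intros)
next
  case False
  then have "(\<lambda>t. plucker cs (M |\<^sub>m (a, b) \<mapsto> t)) = (\<lambda>t. plucker cs M)"
    using plucker_update_other[OF M ab cs] by blast
  moreover have "(\<Sum>l<k. if cs ! l mod n = b then coord (minor_mat k M cs) l (unit_vec k a) else 0) = 0"
    using False by (intro sum.neutral) auto
  ultimately show ?thesis by simp
qed

lemma sum_over_residues:
  fixes g :: "nat \<Rightarrow> 'a::comm_monoid_add"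
  assumes "n > 0" "l \<le> c" and per: "\<And>i. g (i mod n) = g i"
  shows "(\<Sum>i<n. if (i + l) mod n = c mod n then g i else 0) = g (c - l)"
proof -
  have "(i + l) mod n = c mod n \<longleftrightarrow> i = (c - l) mod n" if "i < n" for i
  proof -
    have "(i + l) mod n = ((c - l) + l) mod n \<longleftrightarrow> i mod n = (c - l) mod n"
      by (simp add: nat_mod_eq_iff)
    then show ?thesis using assms(2) that by simp
  qed
  then have "(\<Sum>i<n. if (i + l) mod n = c mod n then g i else 0)
      = (\<Sum>i<n. if i = (c - l) mod n then g ((c - l) mod n) else 0)"
    by (intro sum.cong refl) auto
  also have "\<dots> = g (c - l)" using assms(1) per by simp
  finally show ?thesis .
qed

section \<open>The critical equations\<close>

abbreviation num_cols :: "nat \<Rightarrow> nat \<Rightarrow> nat list" where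
  "num_cols k i \<equiv> [i..<i + k]"

abbreviation den_cols :: "nat \<Rightarrow> nat \<Rightarrow> nat list" where
  "den_cols k i \<equiv> [i..<i + (k - 1)] @ [i + k]"

lemma mod_inj_window:
  fixes x y n :: nat
  assumes "x mod n = y mod n" "x < y + n" "y < x + n"
  shows "x = y"
proof (rule ccontr)
  assume "x \<noteq> y"
  then consider "x < y" | "y < x" by linarith
  then show False
  proof cases
    case 1
    then have "n dvd y - x" using assms(1) by (metis mod_eq_dvd_iff_nat less_imp_le)
    then show False using 1 assms by (auto dest: dvd_imp_le)
  next
    case 2
    then have "n dvd x - y" using assms(1) by (metis mod_eq_dvd_iff_nat less_imp_le)
    then show False using 2 assms by (auto dest: dvd_imp_le)
  qed
qed

lemma den_cols_nth: "l < k \<Longrightarrow> den_cols k i ! l = (if l < k - 1 then i + l else i + k)"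
  by (auto simp: nth_append)

text \<open>
  The logarithmic derivative of a quotient of minors is the difference of two coordinates of a
  unit vector, whichever branch of the logarithm is chosen. In each minor at most one of the \<open>k\<close>
  columns carries the moving entry, since its column indices lie in a window of length
  \<open>k + 1 \<le> n\<close> and are therefore distinct modulo \<open>n\<close>.
\<close>
lemma critical_log_derivative:
  assumes M: "M \<in> carrier_mat k n" and k: "1 \<le> k" "k < n" and crit: "PK_critical k n M"
    and ab: "a < k" "b < n"
  shows "(\<Sum>i<n. (\<Sum>l<k. if (i + l) mod n = b
              then coord (minor_mat k M (num_cols k i)) l (unit_vec k a) else 0)
          - (\<Sum>l<k. if (if l < k - 1 then i + l else i + k) mod n = b
              then coord (minor_mat k M (den_cols k i)) l (unit_vec k a) else 0)) = 0"
proof -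
  define z where "z = M $$ (a, b)"
  define N where "N i t = PK_num k i (M |\<^sub>m (a, b) \<mapsto> t)" for i t
  define E where "E i t = PK_den k i (M |\<^sub>m (a, b) \<mapsto> t)" for i t
  define SN where "SN i = (\<Sum>l<k. if (i + l) mod n = b
              then coord (minor_mat k M (num_cols k i)) l (unit_vec k a) else 0)" for i
  define SE where "SE i = (\<Sum>l<k. if (if l < k - 1 then i + l else i + k) mod n = b
              then coord (minor_mat k M (den_cols k i)) l (unit_vec k a) else 0)" for i
  have self: "M |\<^sub>m (a, b) \<mapsto> z = M"
    using M by (intro eq_matI) (auto simp: update_mat_def z_def)
  have nz: "N i z \<noteq> 0" "E i z \<noteq> 0" if "i < n" for i
    using crit that by (auto simp: PK_critical_def PK_minors_nonzero_def N_def E_def self)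
  have dN: "(N i has_field_derivative N i z * SN i) (at z)" if i: "i < n" for i
  proof -
    have len: "length (num_cols k i) = k" by simp
    have inj: "p = q" if "p < k" "q < k" "num_cols k i ! p mod n = num_cols k i ! q mod n" for p q
      using mod_inj_window[of "i + p" n "i + q"] that k by simp
    have pl: "plucker (num_cols k i) M \<noteq> 0" using nz(1)[OF i] by (simp add: N_def self PK_num_def)
    show ?thesis
      using plucker_log_derivative[OF M ab len inj pl]
      by (simp add: N_def[abs_def] SN_def PK_num_def z_def[symmetric] self cong: if_cong)
  qed
  have dE: "(E i has_field_derivative E i z * SE i) (at z)" if i: "i < n" for i
  proof -
    have len: "length (den_cols k i) = k" using k by simp
    have inj: "p = q" if "p < k" "q < k" "den_cols k i ! p mod n = den_cols k i ! q mod n" for p q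
    proof -
      have "(if p < k - 1 then i + p else i + k) = (if q < k - 1 then i + q else i + k)"
        using that(3) unfolding den_cols_nth[OF that(1)] den_cols_nth[OF that(2)]
        by (rule mod_inj_window) (use that(1,2) k in \<open>simp_all split: if_split\<close>)
      then show ?thesis using that(1,2) by (simp split: if_split_asm)
    qed
    have pl: "plucker (den_cols k i) M \<noteq> 0" using nz(2)[OF i] by (simp add: E_def self PK_den_def)
    have "SE i = (\<Sum>l<k. if den_cols k i ! l mod n = b
              then coord (minor_mat k M (den_cols k i)) l (unit_vec k a) else 0)"
      unfolding SE_def by (intro sum.cong refl) (simp only: lessThan_iff den_cols_nth)
    then show ?thesis
      using plucker_log_derivative[OF M ab len inj pl]
      by (simp add: E_def[abs_def] PK_den_def z_def[symmetric] self)
  qed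
  have "PK_has_partial k n M a b 0" using crit ab by (simp add: PK_critical_def)
  then obtain L where L: "\<And>i. i < n \<Longrightarrow> log_branch_at (\<lambda>t. N i t / E i t) z (L i)"
    and dL: "((\<lambda>t. \<Sum>i<n. L i t) has_field_derivative 0) (at z)"
    by (auto simp: PK_has_partial_def N_def E_def z_def)
  have "(L i has_field_derivative SN i - SE i) (at z)" if i: "i < n" for i
  proof -
    have "((\<lambda>t. N i t / E i t) has_field_derivative
        (N i z * SN i * E i z - N i z * (E i z * SE i)) / (E i z * E i z)) (at z)"
      using dN[OF i] dE[OF i] nz(2)[OF i] by (rule DERIV_divide)
    then have "deriv (\<lambda>t. N i t / E i t) z / (N i z / E i z) = SN i - SE i"
      using nz[OF i] by (simp add: DERIV_imp_deriv field_simps)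
    then show ?thesis
      using log_branch_has_derivative[OF L[OF i]] nz[OF i] by simp
  qed
  then have "((\<lambda>t. \<Sum>i<n. L i t) has_field_derivative (\<Sum>i<n. SN i - SE i)) (at z)"
    by (intro DERIV_sum) auto
  then have "(\<Sum>i<n. SN i - SE i) = 0" using dL DERIV_unique by blast
  then show ?thesis by (simp add: SN_def SE_def)
qed

lemma minor_mat_num_periodic:
  assumes "M \<in> carrier_mat k n"
  shows "minor_mat k M (num_cols k (i mod n)) = minor_mat k M (num_cols k i)"
proof -
  have "map (\<lambda>c. col M (c mod n)) (num_cols k (i mod n)) = map (\<lambda>c. col M (c mod n)) (num_cols k i)"
    by (rule nth_equalityI) (simp_all add: mod_add_left_eq)
  then show ?thesis using assms by (simp add: minor_mat_def)
qed

lemma minor_mat_den_periodic: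
  assumes "M \<in> carrier_mat k n" "1 \<le> k"
  shows "minor_mat k M (den_cols k (i mod n)) = minor_mat k M (den_cols k i)"
proof -
  have "map (\<lambda>c. col M (c mod n)) (den_cols k (i mod n)) = map (\<lambda>c. col M (c mod n)) (den_cols k i)"
    using assms(2)
    by (intro nth_equalityI) (simp_all add: nth_append mod_add_left_eq)
  then show ?thesis using assms by (simp add: minor_mat_def)
qed

lemma coord_unit_expansion:
  fixes w :: "complex vec"
  assumes "A \<in> carrier_mat k k"
  shows "coord A j w = (\<Sum>a<k. w $ a * coord A j (unit_vec k a))"
  using assms by (intro coord_linear) (simp add: if_distrib sum.delta cong: if_cong)

text \<open>
  The critical equations for the entries of column \<open>m + k\<close>, assembled into one equation
  between linear functionals. Summing over residues picks, for each slot \<open>l\<close>, the unique window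
  (up to a multiple of \<open>n\<close>) in which column \<open>m + k\<close> occupies that slot; it occupies the last
  slot of the denominator window starting at \<open>m\<close>, as that window skips column \<open>m + k - 1\<close>.
\<close>
lemma critical_functional:
  assumes M: "M \<in> carrier_mat k n" and k: "1 \<le> k" "k < n" and crit: "PK_critical k n M"
  shows "(\<Sum>l<k. coord (minor_mat k M (num_cols k (m + k - l))) l w)
    = (\<Sum>l<k - 1. coord (minor_mat k M (den_cols k (m + k - l))) l w)
      + coord (minor_mat k M (den_cols k m)) (k - 1) w"
proof -
  define A where "A i = minor_mat k M (num_cols k i)" for i
  define C where "C i = minor_mat k M (den_cols k i)" for i
  have n: "n > 0" using k by simp
  have carr: "A i \<in> carrier_mat k k" "C i \<in> carrier_mat k k" for i
    using k by (auto simp: A_def C_def minor_mat_def)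
  have per: "A (i mod n) = A i" "C (i mod n) = C i" for i
    using minor_mat_num_periodic[OF M] minor_mat_den_periodic[OF M k(1)]
    by (auto simp: A_def C_def)
  have unit: "(\<Sum>l<k. coord (A (m + k - l)) l (unit_vec k a))
      = (\<Sum>l<k - 1. coord (C (m + k - l)) l (unit_vec k a)) + coord (C m) (k - 1) (unit_vec k a)"
    if a: "a < k" for a
  proof -
    let ?e = "unit_vec k a :: complex vec"
    have split: "{..<k} = insert (k - 1) {..<k - 1}" using k by auto
    have "0 = (\<Sum>i<n. \<Sum>l<k. if (i + l) mod n = (m + k) mod n then coord (A i) l ?e else 0)
          - (\<Sum>i<n. \<Sum>l<k. if (if l < k - 1 then i + l else i + k) mod n = (m + k) mod n
                then coord (C i) l ?e else 0)"
      using critical_log_derivative[OF M k crit a mod_less_divisor[OF n, of "m + k"], symmetric]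
      unfolding A_def C_def sum_subtractf .
    also have "(\<Sum>i<n. \<Sum>l<k. if (i + l) mod n = (m + k) mod n then coord (A i) l ?e else 0)
        = (\<Sum>l<k. coord (A (m + k - l)) l ?e)"
      by (subst sum.swap, intro sum.cong refl sum_over_residues) (use n per in auto)
    also have "(\<Sum>i<n. \<Sum>l<k. if (if l < k - 1 then i + l else i + k) mod n = (m + k) mod n
                then coord (C i) l ?e else 0)
        = (\<Sum>l<k. \<Sum>i<n. if (i + (if l < k - 1 then l else k)) mod n = (m + k) mod n
                then coord (C i) l ?e else 0)"
      by (subst sum.swap, intro sum.cong refl) auto
    also have "\<dots> = (\<Sum>l<k. coord (C (m + k - (if l < k - 1 then l else k))) l ?e)"
      by (intro sum.cong refl sum_over_residues) (use n per in auto)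
    also have "\<dots> = (\<Sum>l<k - 1. coord (C (m + k - l)) l ?e) + coord (C m) (k - 1) ?e"
      unfolding split by (simp add: add.commute)
    finally show ?thesis by simp
  qed
  have "(\<Sum>l<k. coord (A (m + k - l)) l w)
      = (\<Sum>l<k. \<Sum>a<k. w $ a * coord (A (m + k - l)) l (unit_vec k a))"
    by (intro sum.cong refl coord_unit_expansion carr)
  also have "\<dots> = (\<Sum>a<k. w $ a * (\<Sum>l<k. coord (A (m + k - l)) l (unit_vec k a)))"
    by (subst sum.swap) (simp add: sum_distrib_left)
  also have "\<dots> = (\<Sum>a<k. w $ a * ((\<Sum>l<k - 1. coord (C (m + k - l)) l (unit_vec k a))
      + coord (C m) (k - 1) (unit_vec k a)))"
    by (intro sum.cong refl) (simp add: unit)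
  also have "\<dots> = (\<Sum>l<k - 1. \<Sum>a<k. w $ a * coord (C (m + k - l)) l (unit_vec k a))
      + (\<Sum>a<k. w $ a * coord (C m) (k - 1) (unit_vec k a))"
    by (subst sum.swap) (simp add: sum_distrib_left distrib_left sum.distrib)
  also have "\<dots> = (\<Sum>l<k - 1. coord (C (m + k - l)) l w) + coord (C m) (k - 1) w"
    by (simp add: coord_unit_expansion[OF carr(2), symmetric])
  finally show ?thesis by (simp add: A_def C_def)
qed

section \<open>Reduction to constant coefficients\<close>

lemma col_minor_mat:
  assumes "M \<in> carrier_mat k n" "l < length cs"
  shows "col (minor_mat k M cs) l = col M (cs ! l mod n)"
  using assms by (intro eq_vecI) (auto simp: minor_mat_def mat_of_cols_index)

text \<open>
  Here \<open>r i t\<close> is the coefficient of column \<open>i + k - t\<close> in the expansion of column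
  \<open>i + k\<close> over the preceding \<open>k\<close> columns. After the exchange formula the numerator and
  denominator coordinates in the critical equation cancel except for multiples of the last
  coordinate functionals \<open>coord (A i) (k - 1)\<close>. Normalised to be 1 on column \<open>i + k\<close>, these
  satisfy a recurrence with the same coefficients \<open>r\<close> as the columns, read backwards.
\<close>
lemma critical_dual_recurrence:
  assumes M: "M \<in> carrier_mat k n" and k: "1 \<le> k" "k < n" and crit: "PK_critical k n M"
  defines "A \<equiv> \<lambda>i. minor_mat k M (num_cols k i)"
    and "v \<equiv> \<lambda>i. col M (i mod n)"
  defines "r \<equiv> \<lambda>i t. coord (A i) (k - t) (v (i + k))"
  shows "A i \<in> carrier_mat k k" and "det (A i) \<noteq> 0" and "A (i + n) = A i"
    and "l < k \<Longrightarrow> col (A i) l = v (i + l)" and "r i 1 \<noteq> 0"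
    and "coord (A m) (k - 1) w / r m 1
      = (\<Sum>t=1..k. r (m + t) t * (coord (A (m + t)) (k - 1) w / r (m + t) 1))"
proof -
  define C where "C i = minor_mat k M (den_cols k i)" for i
  have n: "n > 0" using k by simp
  have carr: "A i \<in> carrier_mat k k" "C i \<in> carrier_mat k k" for i
    using k by (auto simp: A_def C_def minor_mat_def)
  have per: "A (i mod n) = A i" "C (i mod n) = C i" for i
    using minor_mat_num_periodic[OF M] minor_mat_den_periodic[OF M k(1)]
    by (auto simp: A_def C_def)
  have "det (A (i mod n)) \<noteq> 0" "det (C (i mod n)) \<noteq> 0" for i
    using crit M mod_less_divisor[OF n, of i]
    by (auto simp: PK_critical_def PK_minors_nonzero_def PK_num_def PK_den_def plucker_def
        A_def C_def minor_mat_def)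
  then have det: "det (A i) \<noteq> 0" "det (C i) \<noteq> 0" for i
    by (simp_all add: per)
  have colA: "col (A i) l = v (i + l)" if "l < k" for i l
    using that by (simp add: A_def v_def col_minor_mat[OF M])
  have colC: "col (C i) l = v (if l < k - 1 then i + l else i + k)" if "l < k" for i l
  proof -
    have "col (C i) l = v (den_cols k i ! l)"
      using that k by (simp add: C_def v_def col_minor_mat[OF M] del: upt_Suc)
    then show ?thesis unfolding den_cols_nth[OF that] .
  qed
  have S: "Suc (k - 1) = k" and last: "col (C i) (k - 1) = v (i + k)" for i
    using k colC[of "k - 1" i] by auto
  have agree: "col (C i) l = col (A i) l" if "l < k - 1" for i l
    using that colA[of l i] colC[of l i] by simp
  note exch = coord_exchange[where p = "k - 1", unfolded S last, OF carr(1) det(1) carr(2) det(2) agree,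
      unfolded last]
  show "A i \<in> carrier_mat k k" "det (A i) \<noteq> 0" "l < k \<Longrightarrow> col (A i) l = v (i + l)"
    using carr det colA by auto
  show "A (i + n) = A i" using per(1)[of "i + n"] per(1)[of i] by simp
  have rnz: "r i 1 \<noteq> 0" for i using exch(1) by (simp add: r_def)
  then show "r i 1 \<noteq> 0" .
  let ?\<mu> = "\<lambda>i. coord (A i) (k - 1) w / r i 1"
  have split: "{..<k} = insert (k - 1) {..<k - 1}" using k by auto
  have "(\<Sum>l<k - 1. coord (A (m + k - l)) l w) + coord (A (m + 1)) (k - 1) w
      = (\<Sum>l<k - 1. coord (C (m + k - l)) l w) + coord (C m) (k - 1) w"
    using critical_functional[OF M k crit, of m w] k unfolding A_def C_def split
    by (simp add: add.commute)
  also have "(\<Sum>l<k - 1. coord (C (m + k - l)) l w)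
      = (\<Sum>l<k - 1. coord (A (m + k - l)) l w - r (m + k - l) (k - l) * ?\<mu> (m + k - l))"
    by (intro sum.cong refl) (simp add: exch(3) r_def)
  also have "coord (C m) (k - 1) w = ?\<mu> m"
    using exch(2) by (simp add: r_def)
  finally have "?\<mu> m = (\<Sum>l<k - 1. r (m + k - l) (k - l) * ?\<mu> (m + k - l)) + coord (A (m + 1)) (k - 1) w"
    by (simp add: sum_subtractf)
  also have "coord (A (m + 1)) (k - 1) w = r (m + 1) 1 * ?\<mu> (m + 1)"
    using rnz[of "m + 1"] by simp
  also have "(\<Sum>l<k - 1. r (m + k - l) (k - l) * ?\<mu> (m + k - l)) + r (m + 1) 1 * ?\<mu> (m + 1)
      = (\<Sum>l<k. r (m + (k - l)) (k - l) * ?\<mu> (m + (k - l)))"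
    unfolding split using k by (simp add: add.commute)
  also have "\<dots> = (\<Sum>t=1..k. r (m + t) t * ?\<mu> (m + t))"
    by (rule sum_reflect[of "\<lambda>t. r (m + t) t * ?\<mu> (m + t)"])
  finally show "?\<mu> m = (\<Sum>t=1..k. r (m + t) t * ?\<mu> (m + t))" .
qed

text \<open>
  Rescaling the columns by \<open>T\<close> multiplies \<open>q i\<close> by \<open>T (i + k) / T (i + k - 1)\<close>. All these
  coefficients can be made equal to \<open>\<kappa>\<close> consistently around the cycle exactly when \<open>\<kappa> ^ n\<close> is
  their product.
\<close>
lemma cyclic_gauge_exists:
  fixes q :: "nat \<Rightarrow> complex"
  assumes n: "k < n" "1 \<le> k" and nz: "\<And>i. q i \<noteq> 0" and per: "\<And>i. q (i + n) = q i"
  obtains T \<kappa> where "\<kappa> \<noteq> 0" "\<And>i. T i \<noteq> 0" "\<And>i. T (i + n) = T i"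
    "\<And>i. T (i + k) * q i = \<kappa> * T (i + k - 1)"
proof -
  define P where "P = (\<Prod>l<n. q l)"
  have "P \<noteq> 0" using nz by (simp add: P_def)
  define \<kappa> where "\<kappa> = exp (Ln P / of_nat n)"
  have \<kappa>: "\<kappa> \<noteq> 0" "\<kappa> ^ n = P"
    using n \<open>P \<noteq> 0\<close> by (auto simp: \<kappa>_def simp flip: exp_of_nat_mult)
  \<comment> \<open>The shift by \<open>n + 1 - k\<close> is \<open>1 - k\<close> modulo the period \<open>n\<close>, kept nonnegative.\<close>
  define T where "T j = (\<Prod>l<j. \<kappa> / q (l + (n + 1 - k)))" for j
  have Tnz: "T i \<noteq> 0" for i using \<kappa> nz by (simp add: T_def)
  have step: "T (Suc j) = T j * \<kappa> / q (j + (n + 1 - k))" for j by (simp add: T_def)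
  have Tn: "T n = 1"
    using prod.shift_periodic[of q n "n + 1 - k", OF per] \<kappa> \<open>P \<noteq> 0\<close>
    by (simp add: T_def prod_dividef P_def)
  have Tper: "T (i + n) = T i" for i
  proof (induction i)
    case 0
    then show ?case using Tn by (simp add: T_def)
  next
    case (Suc i)
    have "q (i + n + (n + 1 - k)) = q (i + (n + 1 - k))"
      using per[of "i + (n + 1 - k)"] by (simp add: ac_simps)
    then show ?case using Suc step[of i] step[of "i + n"] by simp
  qed
  have "T (i + k) * q i = \<kappa> * T (i + k - 1)" for i
  proof -
    have "i + k - 1 + (n + 1 - k) = i + n" "Suc (i + k - 1) = i + k" using n by auto
    then show ?thesis using step[of "i + k - 1"] per[of i] nz[of i] by simp
  qed
  with \<kappa>(1) Tnz Tper show thesis by (rule that)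
qed

text \<open>
  Let \<open>R\<close> be the rescaled coefficients and \<open>F m s\<close> the value on rescaled column
  \<open>m + k - 1 + s\<close> of the last coordinate functional of window \<open>m\<close>, scaled so that
  \<open>F m 0 = 1\<close>. Expanding the column by
  its recurrence, or the functional by the dual recurrence, evaluates \<open>F m s\<close> in two ways; the
  functional of a window kills its first \<open>k - 1\<close> columns, which cuts both sums off at \<open>s\<close>.
  The two evaluations force \<open>R\<close> to be independent of the position.
\<close>
lemma critical_imp_constant_recurrence:
  assumes M: "M \<in> carrier_mat k n" and k: "1 \<le> k" "k < n" and crit: "PK_critical k n M"
  obtains T \<rho> where "\<And>i. T i \<noteq> 0" "\<And>i. T (i + n) = T i" "\<rho> 1 \<noteq> 0"
    "\<And>i a. a < k \<Longrightarrow> T (i + k) * M $$ (a, (i + k) mod n)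
        = (\<Sum>t=1..k. \<rho> t * (T (i + k - t) * M $$ (a, (i + k - t) mod n)))"
proof -
  define A where "A i = minor_mat k M (num_cols k i)" for i
  define v where "v i = col M (i mod n)" for i
  define r where "r i t = coord (A i) (k - t) (v (i + k))" for i t
  note basic = critical_dual_recurrence[OF M k crit, folded A_def v_def, folded r_def]
  note carr = basic(1) and det = basic(2) and Aper = basic(3) and colA = basic(4)
    and rnz = basic(5) and dual = basic(6)
  have vper: "v (i + n) = v i" for i by (simp add: v_def)
  have rper: "r (i + n) t = r i t" for i t
    using vper[of "i + k"] by (simp add: r_def Aper ac_simps)
  obtain T \<kappa> where T: "\<kappa> \<noteq> 0" "\<And>i. T i \<noteq> 0" "\<And>i. T (i + n) = T i"
    "\<And>i. T (i + k) * r i 1 = \<kappa> * T (i + k - 1)"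
    using cyclic_gauge_exists[OF k(2) k(1), of "\<lambda>i. r i 1"] rnz rper by metis
  have q: "r i 1 = \<kappa> * T (i + k - 1) / T (i + k)" for i
    using T(2,4) by (simp add: field_simps)

  have expand: "v (i + k) $ a = (\<Sum>t=1..k. r i t * v (i + k - t) $ a)" if "a < k" for i a
  proof -
    have "v (i + k) $ a = (\<Sum>l<k. coord (A i) l (v (i + k)) * A i $$ (a, l))"
      by (rule coord_expand[OF carr det that])
    also have "\<dots> = (\<Sum>l<k. r i (k - l) * v (i + k - (k - l)) $ a)"
    proof (intro sum.cong refl)
      fix l assume l: "l \<in> {..<k}"
      then have "A i $$ (a, l) = v (i + l) $ a"
        using colA[of l i] carr[of i] that by (metis carrier_matD index_col lessThan_iff)
      then show "coord (A i) l (v (i + k)) * A i $$ (a, l) = r i (k - l) * v (i + k - (k - l)) $ a"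
        using l by (simp add: r_def)
    qed
    also have "\<dots> = (\<Sum>t=1..k. r i t * v (i + k - t) $ a)"
      by (rule sum_reflect[of "\<lambda>t. r i t * v (i + k - t) $ a"])
    finally show ?thesis .
  qed

  define \<phi> where "\<phi> m w = coord (A m) (k - 1) w" for m w
  have kill: "\<phi> m (v (m + l)) = (if l = k - 1 then 1 else 0)" if "l < k" for m l
    using coord_col[OF carr det, of "k - 1" l m] colA[OF that, of m] that k by (simp add: \<phi>_def)
  define F where "F m s = \<phi> m (v (m + (k - 1) + s)) * T (m + (k - 1) + s) / T (m + (k - 1))" for m s
  define R where "R i t = r i t * T (i + k) / T (i + k - t)" for i t
  have F0: "F m 0 = 1" for m using kill[of "k - 1" m] k T(2) by (simp add: F_def)
  have right: "F m s = (\<Sum>t=1..s. R (m + s - 1) t * F m (s - t))" if s: "1 \<le> s" "s \<le> k" for m s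
  proof -
    define i where "i = m + s - 1"
    have i: "m + (k - 1) + s = i + k" using s k by (simp add: i_def)
    have "\<phi> m (v (i + k)) = (\<Sum>t=1..k. r i t * \<phi> m (v (i + k - t)))"
      unfolding \<phi>_def using carr[of m] by (intro coord_linear) (simp add: expand)
    also have "\<dots> = (\<Sum>t=1..s. r i t * \<phi> m (v (i + k - t)))"
    proof (rule sum_restrict_le[OF s(2)])
      fix t assume t: "s < t" "t \<le> k"
      define l where "l = k - 1 + s - t"
      have "i + k - t = m + l" "l < k" "l \<noteq> k - 1" using t s by (auto simp: l_def i_def)
      then show "r i t * \<phi> m (v (i + k - t)) = 0" using kill[of l m] by simp
    qed
    finally have "F m s = (\<Sum>t=1..s. r i t * \<phi> m (v (i + k - t))) * T (i + k) / T (m + (k - 1))"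
      by (simp only: F_def i)
    also have "\<dots> = (\<Sum>t=1..s. r i t * \<phi> m (v (i + k - t)) * T (i + k) / T (m + (k - 1)))"
      by (simp add: sum_distrib_right sum_divide_distrib)
    also have "\<dots> = (\<Sum>t=1..s. R i t * F m (s - t))"
    proof (intro sum.cong refl)
      fix t assume "t \<in> {1..s}"
      then have e: "m + (k - 1) + (s - t) = i + k - t" using s k by (auto simp: i_def)
      show "r i t * \<phi> m (v (i + k - t)) * T (i + k) / T (m + (k - 1)) = R i t * F m (s - t)"
        unfolding R_def F_def e using T(2) by simp
    qed
    finally show ?thesis by (simp add: i_def)
  qed
  have left: "F m s = (\<Sum>t=1..s. R (m + t) t * F (m + t) (s - t))" if s: "1 \<le> s" "s \<le> k" for m s
  proof -
    define w where "w = v (m + (k - 1) + s)"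
    have "\<phi> m w / r m 1 = (\<Sum>t=1..k. r (m + t) t * (\<phi> (m + t) w / r (m + t) 1))"
      unfolding \<phi>_def by (rule dual)
    also have "\<dots> = (\<Sum>t=1..s. r (m + t) t * (\<phi> (m + t) w / r (m + t) 1))"
    proof (rule sum_restrict_le[OF s(2)])
      fix t assume t: "s < t" "t \<le> k"
      define l where "l = k - 1 + s - t"
      have "m + (k - 1) + s = (m + t) + l" "l < k" "l \<noteq> k - 1" using t s by (auto simp: l_def)
      then have "\<phi> (m + t) w = 0" using kill[of l "m + t"] unfolding w_def by simp
      then show "r (m + t) t * (\<phi> (m + t) w / r (m + t) 1) = 0" by simp
    qed
    finally have "\<phi> m w = r m 1 * (\<Sum>t=1..s. r (m + t) t * (\<phi> (m + t) w / r (m + t) 1))"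
      using rnz[of m] by (simp add: field_simps)
    then have "F m s = r m 1 * (\<Sum>t=1..s. r (m + t) t * (\<phi> (m + t) w / r (m + t) 1))
        * T (m + (k - 1) + s) / T (m + (k - 1))"
      by (simp only: F_def w_def)
    also have "\<dots> = (\<Sum>t=1..s. r m 1 * (r (m + t) t * (\<phi> (m + t) w / r (m + t) 1))
        * T (m + (k - 1) + s) / T (m + (k - 1)))"
      by (simp add: sum_distrib_left sum_distrib_right sum_divide_distrib)
    also have "\<dots> = (\<Sum>t=1..s. R (m + t) t * F (m + t) (s - t))"
    proof (intro sum.cong refl)
      fix t assume t: "t \<in> {1..s}"
      then have e: "m + t + (k - 1) + (s - t) = m + (k - 1) + s" "m + t + k - t = m + k"
        "m + k - 1 = m + (k - 1)" "m + t + k - 1 = m + t + (k - 1)"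
        using k by auto
      show "r m 1 * (r (m + t) t * (\<phi> (m + t) w / r (m + t) 1)) * T (m + (k - 1) + s) / T (m + (k - 1))
          = R (m + t) t * F (m + t) (s - t)"
        unfolding R_def F_def e q w_def using T(1,2) by (simp add: divide_simps)
    qed
    finally show ?thesis .
  qed
  \<comment> \<open>Constancy of \<open>R _ t\<close> holds from index \<open>t - 1\<close> on; periodicity extends it to all indices.\<close>
  have Rper: "R (i + c * n) t = R i t" if "t \<le> k" for i t c
  proof (induction c)
    case (Suc c)
    have "i + Suc c * n + k - t = (i + c * n + k - t) + n" "i + Suc c * n + k = (i + c * n + k) + n"
      "i + Suc c * n = (i + c * n) + n"
      using that by auto
    then show ?case using Suc T(3) rper[of "i + c * n" t] by (simp only: R_def)
  qed simp
  define \<rho> where "\<rho> t = R (t - 1) t" for t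
  have const: "R i t = \<rho> t" if t: "1 \<le> t" "t \<le> k" for i t
  proof -
    have "k * 1 \<le> k * n" using k by (intro mult_le_mono2) simp
    then have "t - 1 \<le> i + k * n" using t by linarith
    moreover have "R ((i + k * n - (t - 1)) + (t - 1)) t = R (t - 1) t"
      using two_sided_recurrence_constant[where F = F and R = R and s = t and k = k,
          OF F0 right left t(2)] t(1) by blast
    ultimately show ?thesis using Rper[OF t(2), of i k] by (simp add: \<rho>_def)
  qed
  show thesis
  proof (rule that[of T \<rho>])
    show "\<rho> 1 \<noteq> 0" using rnz[of 0] T(2) by (simp add: \<rho>_def R_def)
    fix i a assume a: "a < k"
    have ent: "v j $ a = M $$ (a, j mod n)" for j using a M k by (simp add: v_def)
    have "T (i + k) * v (i + k) $ a = (\<Sum>t=1..k. T (i + k) * r i t * v (i + k - t) $ a)"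
      by (simp add: expand[OF a] sum_distrib_left mult_ac)
    also have "\<dots> = (\<Sum>t=1..k. \<rho> t * (T (i + k - t) * v (i + k - t) $ a))"
    proof (intro sum.cong refl)
      fix t assume "t \<in> {1..k}"
      then have "\<rho> t = r i t * T (i + k) / T (i + k - t)" using const[of t i] by (simp add: R_def)
      then show "T (i + k) * r i t * v (i + k - t) $ a = \<rho> t * (T (i + k - t) * v (i + k - t) $ a)"
        using T(2) by simp
    qed
    finally show "T (i + k) * M $$ (a, (i + k) mod n)
        = (\<Sum>t=1..k. \<rho> t * (T (i + k - t) * M $$ (a, (i + k - t) mod n)))"
      by (simp add: ent)
  qed (use T in auto)
qed

section \<open>Periodic solutions and roots of unity\<close>

definition unity_root :: "nat \<Rightarrow> complex" where
  "unity_root n = cis (2 * pi / real n)"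

lemma unity_root_power: "unity_root n ^ j = cis (2 * pi * real j / real n)"
  unfolding unity_root_def Complex.DeMoivre by (simp add: mult_ac)

lemma unity_root_order: "n > 0 \<Longrightarrow> unity_root n ^ n = 1"
  by (simp add: unity_root_power)

lemma unity_root_nonzero: "unity_root n \<noteq> 0"
  by (simp add: unity_root_def)

lemma unity_root_inj: "n > 0 \<Longrightarrow> inj_on (\<lambda>j. unity_root n ^ j) {..<n}"
  using Complex.bij_betw_roots_unity[of n] by (simp add: unity_root_power bij_betw_def)

lemma unity_root_power_mod: "n > 0 \<Longrightarrow> unity_root n ^ (j mod n) = unity_root n ^ j"
proof -
  assume n: "n > 0"
  have "unity_root n ^ j = unity_root n ^ (n * (j div n) + j mod n)" by simp
  also have "\<dots> = (unity_root n ^ n) ^ (j div n) * unity_root n ^ (j mod n)"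
    by (simp only: power_add power_mult)
  finally show ?thesis using n by (simp add: unity_root_order)
qed

lemma unity_root_eq_iff:
  assumes "n > 0"
  shows "unity_root n ^ i = unity_root n ^ j \<longleftrightarrow> i mod n = j mod n"
proof -
  have "unity_root n ^ (i mod n) = unity_root n ^ (j mod n) \<longleftrightarrow> i mod n = j mod n"
    using assms by (intro inj_on_eq_iff[OF unity_root_inj[OF assms]]) auto
  then show ?thesis using assms by (simp add: unity_root_power_mod)
qed

definition dft :: "nat \<Rightarrow> (nat \<Rightarrow> complex) \<Rightarrow> nat \<Rightarrow> complex" where
  "dft n f j = (\<Sum>i<n. f i / unity_root n ^ (i * j)) / of_nat n"

lemma dft_inversion:
  assumes n: "n > 0" and per: "\<And>i. f (i + n) = f i"
  shows "f i = (\<Sum>j<n. unity_root n ^ (i * j) * dft n f j)"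
proof -
  define \<omega> where "\<omega> = unity_root n"
  have \<omega>: "\<omega> \<noteq> 0" "\<omega> ^ n = 1" using n by (auto simp: \<omega>_def unity_root_nonzero unity_root_order)
  have orth: "(\<Sum>j<n. \<omega> ^ (i * j) / \<omega> ^ (l * j)) = (if l = i mod n then of_nat n else 0)" if "l < n" for l
  proof -
    define x where "x = \<omega> ^ i / \<omega> ^ l"
    have "(\<Sum>j<n. \<omega> ^ (i * j) / \<omega> ^ (l * j)) = (\<Sum>j<n. x ^ j)"
      by (simp add: x_def power_mult power_divide)
    moreover have "x = 1 \<longleftrightarrow> l = i mod n"
      using unity_root_eq_iff[OF n, of i l] that \<omega>(1) by (auto simp: x_def \<omega>_def[symmetric])
    moreover have "x ^ n = 1"
    proof -
      have "(\<omega> ^ m) ^ n = 1" for m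
        using \<omega>(2) by (metis power_mult mult.commute power_one)
      then show ?thesis by (simp add: x_def power_divide)
    qed
    ultimately show ?thesis by (simp add: sum_gp_strict geometric_sum)
  qed
  have "f (i mod n) = f i"
  proof -
    have "f (l + c * n) = f l" for c l
    proof (induction c)
      case (Suc c)
      then show ?case using per[of "l + c * n"] by (simp add: ac_simps)
    qed simp
    from this[of "i mod n" "i div n"] show ?thesis by (simp add: mult.commute)
  qed
  have "(\<Sum>j<n. \<omega> ^ (i * j) * dft n f j) = (\<Sum>j<n. \<Sum>l<n. \<omega> ^ (i * j) / \<omega> ^ (l * j) * f l / of_nat n)"
    by (simp add: dft_def \<omega>_def[symmetric] sum_distrib_left sum_divide_distrib mult_ac)
  also have "\<dots> = (\<Sum>l<n. (\<Sum>j<n. \<omega> ^ (i * j) / \<omega> ^ (l * j)) * f l / of_nat n)"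
    by (subst sum.swap) (simp add: sum_distrib_right sum_divide_distrib)
  also have "\<dots> = (\<Sum>l<n. if l = i mod n then f (i mod n) else 0)"
    using n by (intro sum.cong refl) (auto simp: orth)
  also have "\<dots> = f i" using n \<open>f (i mod n) = f i\<close> by simp
  finally show ?thesis by (simp add: \<omega>_def)
qed

lemma dft_shift:
  assumes n: "n > 0" and per: "\<And>i. f (i + n) = f i"
  shows "dft n (\<lambda>i. f (i + s)) j = (unity_root n ^ j) ^ s * dft n f j"
proof -
  define \<omega> where "\<omega> = unity_root n"
  have \<omega>: "\<omega> \<noteq> 0" "\<omega> ^ n = 1" using n by (auto simp: \<omega>_def unity_root_nonzero unity_root_order)
  define g where "g i = f i / \<omega> ^ (i * j)" for i
  have "g (i + n) = g i" for i
    using \<omega> per by (simp add: g_def distrib_right power_add power_mult)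
  then have "(\<Sum>i<n. g (i + s)) = (\<Sum>i<n. g i)" by (rule sum.shift_periodic)
  moreover have "f (i + s) / \<omega> ^ (i * j) = \<omega> ^ (s * j) * g (i + s)" for i
    using \<omega>(1) by (simp add: g_def distrib_right power_add)
  ultimately show ?thesis
    by (simp add: dft_def \<omega>_def[symmetric] g_def[symmetric] mult.commute[of j s] flip: power_mult sum_distrib_left)
qed

text \<open>
  The characteristic polynomial of \<open>f (i + k) = (\<Sum>t=1..k. \<rho> t * f (i + k - t))\<close>.
\<close>
definition char_poly_of :: "nat \<Rightarrow> (nat \<Rightarrow> complex) \<Rightarrow> complex poly" where
  "char_poly_of k \<rho> = monom 1 k - (\<Sum>t=1..k. monom (\<rho> t) (k - t))"

lemma poly_char_poly_of: "poly (char_poly_of k \<rho>) x = x ^ k - (\<Sum>t=1..k. \<rho> t * x ^ (k - t))"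
  by (simp add: char_poly_of_def poly_sum poly_monom)

lemma coeff_char_poly_of:
  "coeff (char_poly_of k \<rho>) i = (if i = k then 1 else if i < k then - \<rho> (k - i) else 0)"
proof -
  have "(\<Sum>t=1..k. if k - t = i then \<rho> t else 0) = (\<Sum>t=1..k. if t = k - i \<and> i < k then \<rho> (k - i) else 0)"
    by (intro sum.cong refl) auto
  also have "\<dots> = (if i < k then \<rho> (k - i) else 0)"
    by (cases "i < k") auto
  finally show ?thesis by (simp add: char_poly_of_def coeff_sum)
qed

text \<open>
  Shifts act on Fourier coefficients by multiplication, so a recurrence becomes multiplication
  by a value of the characteristic polynomial.
\<close>
lemma dft_recurrence:
  assumes n: "n > 0" and per: "\<And>i. f (i + n) = f i"
    and rec: "\<And>i. f (i + k) = (\<Sum>t=1..k. \<rho> t * f (i + k - t))"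
  shows "poly (char_poly_of k \<rho>) (unity_root n ^ j) * dft n f j = 0"
proof -
  have "dft n (\<lambda>i. f (i + k)) j = dft n (\<lambda>i. \<Sum>t=1..k. \<rho> t * f (i + (k - t))) j"
    by (simp add: rec)
  also have "\<dots> = (\<Sum>t=1..k. \<rho> t * dft n (\<lambda>i. f (i + (k - t))) j)"
    by (simp add: dft_def sum_divide_distrib sum_distrib_left) (rule sum.swap)
  finally show ?thesis
    unfolding dft_shift[where f = f, OF n per] poly_char_poly_of left_diff_distrib sum_distrib_right
    by (simp only: mult.assoc diff_self)
qed

text \<open>
  The roots of unity that solve the characteristic equation, recorded as a binary word.
\<close>
definition word_of :: "nat \<Rightarrow> nat \<Rightarrow> (nat \<Rightarrow> complex) \<Rightarrow> bool list" where
  "word_of n k \<rho> = map (\<lambda>j. poly (char_poly_of k \<rho>) (unity_root n ^ j) = 0) [0..<n]"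

definition ones :: "bool list \<Rightarrow> nat list" where
  "ones w = filter (\<lambda>j. w ! j) [0..<length w]"

definition vandermonde :: "nat \<Rightarrow> nat list \<Rightarrow> nat \<Rightarrow> complex mat" where
  "vandermonde n ps m = mat (length ps) m (\<lambda>(a, i). unity_root n ^ (i * (ps ! a)))"

lemma length_ones: "length (ones w) = count_list w True"
proof -
  have "length (filter (\<lambda>j. v ! j) [0..<length v]) = count_list v True" for v
  proof (induction v rule: rev_induct)
    case (snoc x xs)
    have "filter (\<lambda>j. (xs @ [x]) ! j) [0..<length xs] = filter (\<lambda>j. xs ! j) [0..<length xs]"
      by (rule filter_cong) (auto simp: nth_append)
    then show ?case using snoc by simp
  qed simp
  then show ?thesis by (simp add: ones_def)
qed

lemma set_ones: "set (ones w) = {j. j < length w \<and> w ! j}"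
  by (auto simp: ones_def)

lemma distinct_ones: "distinct (ones w)"
  by (simp add: ones_def)

text \<open>
  Fourier inversion, written as a matrix product over any index list that contains the
  support.
\<close>
lemma dft_factorization:
  assumes n: "n > 0" and per: "\<And>a i. a < k \<Longrightarrow> u a (i + n) = u a i"
    and ps: "distinct ps" "set ps \<subseteq> {..<n}" "length ps = k"
    and supp: "\<And>a j. a < k \<Longrightarrow> j < n \<Longrightarrow> j \<notin> set ps \<Longrightarrow> dft n (u a) j = 0"
  shows "mat k m (\<lambda>(a, i). u a i) = mat k k (\<lambda>(a, b). dft n (u a) (ps ! b)) * vandermonde n ps m"
proof (rule eq_matI)
  fix a i assume "a < dim_row (mat k k (\<lambda>(a, b). dft n (u a) (ps ! b)) * vandermonde n ps m)"
    "i < dim_col (mat k k (\<lambda>(a, b). dft n (u a) (ps ! b)) * vandermonde n ps m)"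
  then have a: "a < k" and i: "i < m" by (auto simp: vandermonde_def)
  have "u a i = (\<Sum>j<n. unity_root n ^ (i * j) * dft n (u a) j)"
    by (rule dft_inversion[where f = "u a", OF n per[OF a]])
  also have "\<dots> = (\<Sum>j\<in>set ps. unity_root n ^ (i * j) * dft n (u a) j)"
    using ps(2) supp[OF a] by (intro sum.mono_neutral_right) auto
  also have "\<dots> = (\<Sum>b<k. unity_root n ^ (i * (ps ! b)) * dft n (u a) (ps ! b))"
    by (rule sum.reindex_bij_betw[symmetric]) (use bij_betw_nth[OF ps(1)] ps(3) in auto)
  finally show "mat k m (\<lambda>(a, i). u a i) $$ (a, i)
      = (mat k k (\<lambda>(a, b). dft n (u a) (ps ! b)) * vandermonde n ps m) $$ (a, i)"
    using a i ps(3) by (simp add: vandermonde_def scalar_prod_def atLeast0LessThan mult.commute)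
qed (auto simp: vandermonde_def ps)

lemma det_zero_column:
  assumes "A \<in> carrier_mat k k" "l < k" "\<And>a. a < k \<Longrightarrow> A $$ (a, l) = 0"
  shows "det A = (0 :: complex)"
  using laplace_expansion_column[OF assms(1,2)] assms(3) by simp

lemma card_char_roots_le:
  assumes "n > 0"
  shows "card {j. j < n \<and> poly (char_poly_of k \<rho>) (unity_root n ^ j) = 0} \<le> k"
proof -
  let ?p = "char_poly_of k \<rho>" and ?J = "{j. j < n \<and> poly (char_poly_of k \<rho>) (unity_root n ^ j) = 0}"
  have deg: "degree ?p \<le> k" by (rule degree_le) (simp add: coeff_char_poly_of)
  have "coeff ?p k \<noteq> 0" by (simp add: coeff_char_poly_of)
  then have nz: "?p \<noteq> 0" by auto
  have "card ?J = card ((\<lambda>j. unity_root n ^ j) ` ?J)"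
    using unity_root_inj[OF assms] by (intro card_image[symmetric]) (auto simp: inj_on_def)
  also have "\<dots> \<le> card {x. poly ?p x = 0}"
    using poly_roots_finite[OF nz] by (intro card_mono) auto
  also have "\<dots> \<le> degree ?p" by (rule card_poly_roots_bound[OF nz])
  finally show ?thesis using deg by simp
qed

text \<open>
  At most \<open>k\<close> roots of unity are roots of the characteristic polynomial. If there were fewer,
  padding the list of them to length \<open>k\<close> would factor the nonsingular matrix of the first \<open>k\<close>
  columns through a matrix with a zero column.
\<close>
lemma recurrence_imp_vandermonde:
  assumes n: "0 < k" "k \<le> n" and per: "\<And>a i. a < k \<Longrightarrow> u a (i + n) = u a i"
    and rec: "\<And>a i. a < k \<Longrightarrow> u a (i + k) = (\<Sum>t=1..k. \<rho> t * u a (i + k - t))"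
    and det: "det (mat k k (\<lambda>(a, i). u a i)) \<noteq> 0"
  shows "word_of n k \<rho> \<in> words n k"
    and "\<exists>G \<in> carrier_mat k k. det G \<noteq> 0 \<and>
          mat k n (\<lambda>(a, i). u a i) = G * vandermonde n (ones (word_of n k \<rho>)) n"
    and "det (vandermonde n (ones (word_of n k \<rho>)) k) \<noteq> 0"
proof -
  let ?w = "word_of n k \<rho>"
  have n0: "n > 0" using n by simp
  define J where "J = {j. j < n \<and> poly (char_poly_of k \<rho>) (unity_root n ^ j) = 0}"
  have vanish: "dft n (u a) j = 0" if "a < k" "j < n" "j \<notin> J" for a j
    using dft_recurrence[OF n0 per[OF that(1)] rec[OF that(1)], of j] that by (auto simp: J_def)
  have J: "set (ones ?w) = J" by (auto simp: set_ones word_of_def J_def)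
  have Jn: "J \<subseteq> {..<n}" "finite J" by (auto simp: J_def)
  have "card J \<le> k" using card_char_roots_le[OF n0] by (simp add: J_def)
  then obtain J' where J': "J \<subseteq> J'" "J' \<subseteq> {..<n}" "card J' = k"
    using exists_subset_between[of J k "{..<n}"] Jn n(2) by auto
  have finJ': "finite J'" using J'(2) finite_subset by blast
  define ps where "ps = sorted_list_of_set J'"
  have ps: "distinct ps" "set ps = J'" "length ps = k"
    using finJ' J'(3) by (auto simp: ps_def)
  have vanish': "dft n (u a) j = 0" if "a < k" "j < n" "j \<notin> set ps" for a j
    using vanish that ps(2) J'(1) by blast
  have psn: "set ps \<subseteq> {..<n}" using ps(2) J'(2) by simp
  have "mat k k (\<lambda>(a, i). u a i) = mat k k (\<lambda>(a, b). dft n (u a) (ps ! b)) * vandermonde n ps k"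
    by (rule dft_factorization[OF n0 per ps(1) psn ps(3) vanish'])
  then have "det (mat k k (\<lambda>(a, b). dft n (u a) (ps ! b))) \<noteq> 0"
    using det ps(3) by (auto simp: det_mult[of _ k] vandermonde_def)
  moreover have "det (mat k k (\<lambda>(a, b). dft n (u a) (ps ! b))) = 0" if "l < k" "ps ! l \<notin> J" for l
  proof (rule det_zero_column[OF _ that(1)])
    fix a assume "a < k"
    moreover have "ps ! l < n" using that ps(3) psn by (metis lessThan_iff nth_mem subsetD)
    ultimately show "mat k k (\<lambda>(a, b). dft n (u a) (ps ! b)) $$ (a, l) = 0"
      using vanish that by simp
  qed simp
  ultimately have "ps ! l \<in> J" if "l < k" for l using that by blast
  then have "J' \<subseteq> J" using ps(2,3) by (auto simp: in_set_conv_nth)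
  then have "card J = k" using J' by auto
  then have len: "length (ones ?w) = k"
    using distinct_card[OF distinct_ones, of ?w] J by simp
  then show "?w \<in> words n k" by (simp add: words_def word_of_def flip: length_ones)
  have onesn: "set (ones ?w) \<subseteq> {..<n}" using J Jn by simp
  have vanish'': "dft n (u a) j = 0" if "a < k" "j < n" "j \<notin> set (ones ?w)" for a j
    using vanish that J by blast
  define G where "G = mat k k (\<lambda>(a, b). dft n (u a) (ones ?w ! b))"
  have G: "G \<in> carrier_mat k k" by (simp add: G_def)
  have fac: "mat k m (\<lambda>(a, i). u a i) = G * vandermonde n (ones ?w) m" for m
    unfolding G_def by (rule dft_factorization[OF n0 per distinct_ones onesn len vanish''])
  have V: "vandermonde n (ones ?w) k \<in> carrier_mat k k" using len by (simp add: vandermonde_def)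
  have "det G * det (vandermonde n (ones ?w) k) \<noteq> 0"
    using det unfolding fac[of k] det_mult[OF G V] .
  then show "det (vandermonde n (ones ?w) k) \<noteq> 0"
    and "\<exists>G \<in> carrier_mat k k. det G \<noteq> 0 \<and>
          mat k n (\<lambda>(a, i). u a i) = G * vandermonde n (ones ?w) n"
    using G fac[of n] by auto
qed

text \<open>
  If the word were fixed by rotation through \<open>m\<close>, its \<open>k\<close> roots would be stable under
  multiplication by \<open>c = unity_root n ^ m\<close>. Then \<open>p (c * x) - c ^ k * p x\<close>, of degree below
  \<open>k\<close>, has \<open>k\<close> roots and vanishes; its coefficient at \<open>k - 1\<close> gives \<open>c = 1\<close> because
  \<open>\<rho> 1\<close>, the sum of the roots, is not zero.
\<close>
lemma word_of_primitive:
  assumes n: "0 < k" "0 < n" and \<rho>: "\<rho> 1 \<noteq> 0" and w: "word_of n k \<rho> \<in> words n k"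
  shows "primitive (word_of n k \<rho>)"
proof -
  let ?w = "word_of n k \<rho>" and ?p = "char_poly_of k \<rho>"
  have nth: "?w ! j \<longleftrightarrow> poly ?p (unity_root n ^ j) = 0" if "j < n" for j
    using that by (simp add: word_of_def)
  have len: "length ?w = n" by (simp add: word_of_def)
  have "rotate m ?w \<noteq> ?w" if m: "0 < m" "m < n" for m
  proof
    assume rot: "rotate m ?w = ?w"
    define c where "c = unity_root n ^ m"
    have c: "c \<noteq> 0" "c \<noteq> 1"
      using unity_root_nonzero unity_root_eq_iff[OF n(2), of m 0] m by (auto simp: c_def)
    define Q where "Q = pcompose ?p [:0, c:] - Polynomial.smult (c ^ k) ?p"
    have coeffQ: "coeff Q i = (c ^ i - c ^ k) * coeff ?p i" for i
      by (simp add: Q_def coeff_pcompose_linear algebra_simps)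
    have "coeff Q i = 0" if "i > k - 1" for i
      using that by (auto simp: coeffQ coeff_char_poly_of)
    then have "degree Q \<le> k - 1" by (intro degree_le) auto
    have "poly Q (unity_root n ^ j) = 0" if j: "j \<in> set (ones ?w)" for j
    proof -
      have j: "j < n" "?w ! j" using j len by (auto simp: set_ones)
      then have "?w ! ((m + j) mod n)"
        using nth_rotate[of j ?w m] rot len by simp
      then have "poly ?p (unity_root n ^ (m + j)) = 0"
        using nth[of "(m + j) mod n"] n by (simp add: unity_root_power_mod)
      then show ?thesis
        using j nth by (simp add: Q_def poly_pcompose c_def power_add mult.commute)
    qed
    then have sub: "(\<lambda>j. unity_root n ^ j) ` set (ones ?w) \<subseteq> {x. poly Q x = 0}" by auto
    have "inj_on (\<lambda>j. unity_root n ^ j) (set (ones ?w))"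
      using unity_root_inj[OF n(2)] by (rule inj_on_subset) (auto simp: set_ones len)
    then have card: "card ((\<lambda>j. unity_root n ^ j) ` set (ones ?w)) = k"
      using w by (simp add: card_image distinct_card[OF distinct_ones] length_ones words_def)
    have "Q = 0"
    proof (rule ccontr)
      assume "Q \<noteq> 0"
      then have "k \<le> degree Q"
        using card_mono[OF poly_roots_finite sub] card_poly_roots_bound[of Q] card by force
      then show False using \<open>degree Q \<le> k - 1\<close> n by simp
    qed
    moreover obtain l where l: "k = Suc l" using n(1) by (cases k) auto
    ultimately have "(c ^ l - c ^ Suc l) * \<rho> 1 = 0"
      using coeffQ[of l] by (simp add: coeff_char_poly_of)
    then show False using \<rho> c by simp
  qed
  then show ?thesis by (simp add: primitive_def len)
qed

text \<open>
  The twisted coefficients are those satisfied by \<open>f i / unity_root n ^ (m * i)\<close> when \<open>f\<close>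
  satisfies the original recurrence. So rotating the word amounts to rescaling columns.
\<close>
lemma word_of_twist:
  assumes n: "0 < n"
  shows "word_of n k (\<lambda>t. \<rho> t / unity_root n ^ (m * t)) = rotate m (word_of n k \<rho>)"
proof (rule nth_equalityI)
  define c where "c = unity_root n ^ m"
  have c: "c \<noteq> 0" by (simp add: c_def unity_root_nonzero)
  fix j assume "j < length (word_of n k (\<lambda>t. \<rho> t / unity_root n ^ (m * t)))"
  then have j: "j < n" by (simp add: word_of_def)
  have scale: "c ^ k * poly (char_poly_of k (\<lambda>t. \<rho> t / unity_root n ^ (m * t))) x
      = poly (char_poly_of k \<rho>) (c * x)" for x
  proof -
    have "c ^ k * (\<rho> t / c ^ t * x ^ (k - t)) = \<rho> t * (c * x) ^ (k - t)" if "t \<in> {1..k}" for t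
      using that c by (simp add: power_diff power_mult_distrib)
    then show ?thesis
      by (simp add: poly_char_poly_of right_diff_distrib power_mult_distrib sum_distrib_left power_mult
          flip: c_def)
  qed
  have "poly (char_poly_of k \<rho>) (c * unity_root n ^ j) = poly (char_poly_of k \<rho>) (unity_root n ^ ((m + j) mod n))"
    using n by (simp add: c_def unity_root_power_mod power_add)
  then show "word_of n k (\<lambda>t. \<rho> t / unity_root n ^ (m * t)) ! j = rotate m (word_of n k \<rho>) ! j"
    using j n scale[of "unity_root n ^ j"] c by (auto simp: nth_rotate word_of_def)
qed (simp add: word_of_def)

section \<open>Torus orbits of critical points\<close>

lemma inverse_matrix_exists:
  fixes G :: "complex mat"
  assumes "G \<in> carrier_mat k k" "det G \<noteq> 0"
  obtains B where "B \<in> carrier_mat k k" "B * G = 1\<^sub>m k"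
proof -
  note adj = adj_mat[OF assms(1)]
  define B where "B = (1 / det G) \<cdot>\<^sub>m adj_mat G"
  have "B * G = (1 / det G) \<cdot>\<^sub>m (adj_mat G * G)"
    unfolding B_def by (rule mult_smult_assoc_mat[OF adj(1) assms(1)])
  also have "\<dots> = 1\<^sub>m k" unfolding adj(3) using assms(2) by (intro eq_matI) auto
  finally show thesis using adj(1) by (intro that[of B]) (auto simp: B_def)
qed

lemma mat_diag_inverse:
  fixes d :: "nat \<Rightarrow> complex"
  assumes "\<And>i. i < n \<Longrightarrow> d i \<noteq> 0"
  shows "mat_diag n d * mat_diag n (\<lambda>i. 1 / d i) = 1\<^sub>m n"
    and "mat_diag n (\<lambda>i. 1 / d i) * mat_diag n d = 1\<^sub>m n"
  unfolding mat_diag_diag by (rule eq_matI; simp add: mat_diag_def assms)+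

lemma mult_assoc_sandwich:
  fixes B :: "complex mat"
  assumes "B \<in> carrier_mat k k" "g \<in> carrier_mat k k" "M \<in> carrier_mat k n"
    "D \<in> carrier_mat n n" "E \<in> carrier_mat n n"
  shows "B * (g * M * D) * E = (B * g) * M * (D * E)"
  using assms
  by (simp add: assoc_mult_mat[of _ k k _ n _ n] assoc_mult_mat[of _ k n _ n _ n]
      assoc_mult_mat[of _ k k _ k _ n])

lemma diagonal_invertible_iff:
  fixes t :: "complex mat"
  assumes "t \<in> carrier_mat n n"
  shows "diagonal_mat t \<and> invertible_mat t \<longleftrightarrow> (\<exists>d. (\<forall>i<n. d i \<noteq> 0) \<and> t = mat_diag n d)"
proof
  assume t: "diagonal_mat t \<and> invertible_mat t"
  then obtain B where B: "inverts_mat t B" "inverts_mat B t" by (auto simp: invertible_mat_def)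
  have dimB: "dim_row B = n" "dim_col B = n"
    using B assms unfolding inverts_mat_def
    by (metis index_mult_mat(2,3) index_one_mat(2,3) carrier_matD)+
  have "t $$ (i, i) \<noteq> 0" if i: "i < n" for i
  proof
    assume "t $$ (i, i) = 0"
    then have "t $$ (i, j) = 0" if "j < n" for j
      using t assms i that by (cases "i = j") (auto simp: diagonal_mat_def)
    then have "(t * B) $$ (i, i) = 0"
      using i assms dimB by (simp add: scalar_prod_def)
    then show False using B(1) i assms by (simp add: inverts_mat_def)
  qed
  moreover have "t = mat_diag n (\<lambda>i. t $$ (i, i))"
    using t assms by (intro eq_matI) (auto simp: mat_diag_def diagonal_mat_def)
  ultimately show "\<exists>d. (\<forall>i<n. d i \<noteq> 0) \<and> t = mat_diag n d"
    by (intro exI[of _ "\<lambda>i. t $$ (i, i)"] conjI allI impI)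
next
  assume "\<exists>d. (\<forall>i<n. d i \<noteq> 0) \<and> t = mat_diag n d"
  then obtain d where d: "\<And>i. i < n \<Longrightarrow> d i \<noteq> 0" "t = mat_diag n d" by blast
  have "inverts_mat t (mat_diag n (\<lambda>i. 1 / d i))" "inverts_mat (mat_diag n (\<lambda>i. 1 / d i)) t"
  proof -
    have "dim_row (mat_diag n f) = n" for f :: "nat \<Rightarrow> complex"
      using mat_diag_dim by (rule carrier_matD)
    moreover have "mat_diag n d * mat_diag n (\<lambda>i. 1 / d i) = 1\<^sub>m n"
      "mat_diag n (\<lambda>i. 1 / d i) * mat_diag n d = 1\<^sub>m n"
      using mat_diag_inverse[of n d] d(1) by blast+
    ultimately show "inverts_mat t (mat_diag n (\<lambda>i. 1 / d i))"
      "inverts_mat (mat_diag n (\<lambda>i. 1 / d i)) t"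
      by (simp_all only: inverts_mat_def d(2))
  qed
  moreover have "square_mat t" using assms by simp
  ultimately have "invertible_mat t" unfolding invertible_mat_def by blast
  moreover have "diagonal_mat t" by (simp add: d(2) diagonal_mat_def mat_diag_def)
  ultimately show "diagonal_mat t \<and> invertible_mat t" by blast
qed

lemma X_rel_iff:
  "(M, N) \<in> X_rel k n \<longleftrightarrow> M \<in> X_mats k n \<and> N \<in> X_mats k n \<and>
    (\<exists>g d. g \<in> carrier_mat k k \<and> det g = 1 \<and> (\<forall>i<n. d i \<noteq> 0) \<and> N = g * M * mat_diag n d)"
proof -
  have "(\<exists>t \<in> carrier_mat n n. det g = 1 \<and> diagonal_mat t \<and> invertible_mat t \<and> N = g * M * t)
      \<longleftrightarrow> (\<exists>d. det g = 1 \<and> (\<forall>i<n. d i \<noteq> 0) \<and> N = g * M * mat_diag n d)" for g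
    using diagonal_invertible_iff[of _ n] mat_diag_dim[of n] by metis
  then show ?thesis by (auto simp: X_rel_def)
qed

lemma equiv_X_rel: "equiv (X_mats k n) (X_rel k n)"
proof (rule equivI)
  show "X_rel k n \<subseteq> X_mats k n \<times> X_mats k n" by (auto simp: X_rel_iff)
  show "refl_on (X_mats k n) (X_rel k n)"
  proof (rule refl_onI)
    fix M assume M: "M \<in> X_mats k n"
    then have "M \<in> carrier_mat k n" by (simp add: X_mats_def)
    then have "M = 1\<^sub>m k * M * mat_diag n (\<lambda>_. 1)" by simp
    then show "(M, M) \<in> X_rel k n" unfolding X_rel_iff using M
      by (intro conjI exI[of _ "1\<^sub>m k"] exI[of _ "\<lambda>_. 1"]) auto
  qed
  show "sym (X_rel k n)"
  proof (rule symI)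
    fix M N assume "(M, N) \<in> X_rel k n"
    then obtain g d where MN: "M \<in> X_mats k n" "N \<in> X_mats k n"
      and g: "g \<in> carrier_mat k k" "det g = 1" and d: "\<And>i. i < n \<Longrightarrow> d i \<noteq> 0"
      and N: "N = g * M * mat_diag n d" unfolding X_rel_iff by blast
    have M: "M \<in> carrier_mat k n" using MN by (simp add: X_mats_def)
    obtain B where B: "B \<in> carrier_mat k k" "B * g = 1\<^sub>m k"
      using inverse_matrix_exists[of g k] g by auto
    have "det B = 1" using det_mult[OF B(1) g(1)] g(2) B(2) by simp
    have "B * N * mat_diag n (\<lambda>i. 1 / d i) = (B * g) * M * (mat_diag n d * mat_diag n (\<lambda>i. 1 / d i))"
      unfolding N by (rule mult_assoc_sandwich[OF B(1) g(1) M]) simp_all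
    also have "mat_diag n d * mat_diag n (\<lambda>i. 1 / d i) = 1\<^sub>m n"
      using d by (rule mat_diag_inverse)
    also have "B * g * M * 1\<^sub>m n = M" using M by (simp add: B(2))
    finally have "M = B * N * mat_diag n (\<lambda>i. 1 / d i)" by simp
    then show "(N, M) \<in> X_rel k n" unfolding X_rel_iff
      using MN B(1) \<open>det B = 1\<close> d
      by (intro conjI exI[of _ B] exI[of _ "\<lambda>i. 1 / d i"]) auto
  qed
  show "trans (X_rel k n)"
  proof (rule transI)
    fix M N P assume "(M, N) \<in> X_rel k n" "(N, P) \<in> X_rel k n"
    then obtain g d g' d' where MP: "M \<in> X_mats k n" "P \<in> X_mats k n"
      and g: "g \<in> carrier_mat k k" "det g = 1" "g' \<in> carrier_mat k k" "det g' = 1"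
      and d: "\<And>i. i < n \<Longrightarrow> d i \<noteq> 0" "\<And>i. i < n \<Longrightarrow> d' i \<noteq> 0"
      and N: "N = g * M * mat_diag n d" and P: "P = g' * N * mat_diag n d'"
      unfolding X_rel_iff by blast
    have M: "M \<in> carrier_mat k n" using MP by (simp add: X_mats_def)
    have P: "P = (g' * g) * M * mat_diag n (\<lambda>i. d i * d' i)"
      unfolding P N mult_assoc_sandwich[OF g(3,1) M mat_diag_dim mat_diag_dim] mat_diag_diag ..
    show "(M, P) \<in> X_rel k n" unfolding X_rel_iff
      using MP g d P det_mult[OF g(3,1)]
      by (intro conjI exI[of _ "g' * g"] exI[of _ "\<lambda>i. d i * d' i"]) auto
  qed
qed

lemma (in vec_space) rank_le_dim_row:
  assumes "A \<in> carrier_mat n nc"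
  shows "rank A \<le> n"
proof -
  have "set (cols A) \<subseteq> carrier_vec n" using assms cols_dim by blast
  then show ?thesis
    unfolding rank_def
    using subspace_dim[OF span_is_subspace fin_dim fin_dim_span_cols[OF assms]] by (simp add: dim_is_n)
qed

text \<open>
  The first \<open>k\<close> columns already have rank \<open>k\<close>, and no entry vanishes, being a power of a
  root of unity.
\<close>
lemma vandermonde_in_X_mats:
  assumes k: "0 < k" "k \<le> n" and ps: "length ps = k" and det: "det (vandermonde n ps k) \<noteq> 0"
  shows "vandermonde n ps n \<in> X_mats k n"
proof -
  let ?V = "vandermonde n ps n"
  have V: "?V \<in> carrier_mat k n" using ps by (simp add: vandermonde_def)
  have J: "{j. j < n \<and> j \<in> {..<k}} = {..<k}" using k by auto
  have pick: "pick {..<k} j = j" if "j < k" for j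
  proof -
    have "{a \<in> {..<k}. a < j} = {..<j}" using that by auto
    then show ?thesis using pick_card_in_set[of j "{..<k}"] that by simp
  qed
  have "submatrix ?V UNIV {..<k} = vandermonde n ps k"
    using V ps J k
    by (intro eq_matI) (auto simp: submatrix_def pick_UNIV pick vandermonde_def)
  then have "card {j. j < n \<and> j \<in> {..<k}} \<le> vec_space.rank k ?V"
    using det by (intro vec_space.rank_gt_minor[OF V, of UNIV]) simp
  moreover have "vec_space.rank k ?V \<le> k" by (rule vec_space.rank_le_dim_row[OF V])
  ultimately have "vec_space.rank k ?V = k" unfolding J by simp
  moreover have "col ?V j \<noteq> 0\<^sub>v k" if "j < n" for j
  proof
    assume "col ?V j = 0\<^sub>v k"
    then have "?V $$ (0, j) = 0" using V that k by (metis carrier_matD index_col index_zero_vec(1))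
    then show False using that k ps unity_root_nonzero by (simp add: vandermonde_def)
  qed
  ultimately show ?thesis using V by (simp add: X_mats_def)
qed

text \<open>
  A cyclic gauge makes the columns a periodic solution of a recurrence, and a further twist by
  powers of a root of unity rotates the associated primitive word to its Lyndon
  representative. This gives \<open>M * diag S = G * V\<close> with \<open>V\<close> the Vandermonde matrix of that
  word. To have determinant 1 on the left, \<open>G\<close> is divided by a \<open>k\<close>-th root \<open>c\<close> of its
  determinant, and the torus element absorbs the factor.
\<close>
lemma critical_imp_vandermonde:
  assumes k: "1 \<le> k" "k < n" and X: "M \<in> X_mats k n" and crit: "PK_critical k n M"
  obtains w where "w \<in> lyndon_words k (n - k)" "(M, vandermonde n (ones w) n) \<in> X_rel k n"
proof -
  have M: "M \<in> carrier_mat k n" using X by (simp add: X_mats_def)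
  have k0: "0 < k" "k \<le> n" "0 < n" using k by auto
  obtain T \<rho> where T: "\<And>i. T i \<noteq> 0" "\<And>i. T (i + n) = T i" and \<rho>: "\<rho> 1 \<noteq> 0"
    and rec: "\<And>i a. a < k \<Longrightarrow> T (i + k) * M $$ (a, (i + k) mod n)
        = (\<Sum>t=1..k. \<rho> t * (T (i + k - t) * M $$ (a, (i + k - t) mod n)))"
    using critical_imp_constant_recurrence[OF M k crit] by blast
  have det: "det (mat k k (\<lambda>(a, i). S i * M $$ (a, i mod n))) \<noteq> 0" if S: "\<And>i. S i \<noteq> 0" for S
  proof -
    let ?A = "minor_mat k M (num_cols k 0)"
    have A: "?A \<in> carrier_mat k k" "det ?A \<noteq> 0"
      using critical_dual_recurrence(1,2)[OF M k crit, of 0] by auto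
    have "mat k k (\<lambda>(a, i). S i * M $$ (a, i mod n)) = ?A * mat_diag k S"
      unfolding mat_diag_mult_right[OF A(1)] using M k
      by (intro eq_matI) (auto simp: minor_mat_def mat_of_cols_index)
    moreover have "det (mat_diag k S) \<noteq> 0"
    proof -
      have "mat_diag k S * mat_diag k (\<lambda>i. 1 / S i) = 1\<^sub>m k"
        using S by (rule mat_diag_inverse)
      then show ?thesis
        using det_mult[of "mat_diag k S" k "mat_diag k (\<lambda>i. 1 / S i)"] by auto
    qed
    ultimately show ?thesis using A by (simp add: det_mult[of _ k])
  qed
  let ?w = "word_of n k \<rho>"
  have w: "?w \<in> words n k"
    by (rule recurrence_imp_vandermonde(1)[OF k0(1,2), where u = "\<lambda>a i. T i * M $$ (a, i mod n)"])
      (use T rec det[of T] in auto)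
  then have prim: "primitive ?w" using word_of_primitive[of k n \<rho>, OF k0(1,3) \<rho>] by blast
  have "length ?w = n" by (simp add: word_of_def)
  then have "?w \<noteq> []" using k0 by auto
  then obtain m where lyn: "lyndon_word (rotate m ?w)"
    using lyndon_rotation_exists[OF prim] by blast
  define z where "z i = unity_root n ^ (m * i)" for i
  have z: "z i \<noteq> 0" "z (i + j) = z i * z j" "z n = 1" for i j
    using unity_root_nonzero unity_root_order[OF k0(3)]
    by (auto simp: z_def distrib_left power_add mult.commute[of m n] power_mult)
  define S where "S i = T i / z i" for i
  define \<sigma> where "\<sigma> t = \<rho> t / z t" for t
  have S: "S i \<noteq> 0" "S (i + n) = S i" for i using T z by (auto simp: S_def)
  have recS: "S (i + k) * M $$ (a, (i + k) mod n)
      = (\<Sum>t=1..k. \<sigma> t * (S (i + k - t) * M $$ (a, (i + k - t) mod n)))" if a: "a < k" for a i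
  proof -
    have "S (i + k) * M $$ (a, (i + k) mod n)
        = (\<Sum>t=1..k. \<rho> t * (T (i + k - t) * M $$ (a, (i + k - t) mod n)) / z (i + k))"
      using rec[OF a, of i] by (simp add: S_def flip: sum_divide_distrib)
    also have "\<dots> = (\<Sum>t=1..k. \<sigma> t * (S (i + k - t) * M $$ (a, (i + k - t) mod n)))"
    proof (intro sum.cong refl)
      fix t assume "t \<in> {1..k}"
      then have "z (i + k) = z t * z (i + k - t)" using z(2)[of t "i + k - t"] by simp
      then show "\<rho> t * (T (i + k - t) * M $$ (a, (i + k - t) mod n)) / z (i + k)
          = \<sigma> t * (S (i + k - t) * M $$ (a, (i + k - t) mod n))"
        by (simp add: \<sigma>_def S_def)
    qed
    finally show ?thesis .
  qed
  let ?v = "rotate m ?w" and ?u = "\<lambda>a i. S i * M $$ (a, i mod n)"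
  have v: "word_of n k \<sigma> = ?v" using word_of_twist[OF k0(3), of k \<rho> m] by (simp add: \<sigma>_def[abs_def] z_def)
  have per: "?u a (i + n) = ?u a i" for a i using S by simp
  note vand = recurrence_imp_vandermonde[OF k0(1,2), where u = ?u and \<rho> = \<sigma>, OF per recS det[OF S(1)],
      unfolded v]
  obtain G where G: "G \<in> carrier_mat k k" "det G \<noteq> 0"
    and fac: "mat k n (\<lambda>(a, i). ?u a i) = G * vandermonde n (ones ?v) n"
    using vand(2) by blast
  have len: "length (ones ?v) = k" using vand(1) by (simp add: length_ones words_def)
  let ?V = "vandermonde n (ones ?v) n"
  have VX: "?V \<in> X_mats k n" by (rule vandermonde_in_X_mats[OF k0(1,2) len vand(3)])
  then have V: "?V \<in> carrier_mat k n" by (simp add: X_mats_def)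
  obtain B where B: "B \<in> carrier_mat k k" "B * G = 1\<^sub>m k" using inverse_matrix_exists[OF G] by blast
  define c where "c = exp (Ln (det G) / of_nat k)"
  have c: "c \<noteq> 0" "c ^ k = det G"
    using k G(2) by (auto simp: c_def simp flip: exp_of_nat_mult)
  have "det (c \<cdot>\<^sub>m B) = 1"
    using det_mult[OF B(1) G(1)] B c by (simp add: det_smult mult.commute)
  moreover have "?V = (c \<cdot>\<^sub>m B) * M * mat_diag n (\<lambda>i. S i / c)"
  proof -
    have "M * mat_diag n S = mat k n (\<lambda>(a, i). ?u a i)"
      unfolding mat_diag_mult_right[OF M] using M by (intro eq_matI) auto
    then have MS: "M * mat_diag n S = G * ?V" using fac by simp
    have "mat_diag n (\<lambda>i. S i / c) = (1 / c) \<cdot>\<^sub>m mat_diag n S"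
      by (intro eq_matI) (auto simp: mat_diag_def)
    then have "(c \<cdot>\<^sub>m B) * M * mat_diag n (\<lambda>i. S i / c) = (c \<cdot>\<^sub>m (B * M)) * ((1 / c) \<cdot>\<^sub>m mat_diag n S)"
      by (simp only: mult_smult_assoc_mat[OF B(1) M])
    also have "\<dots> = c \<cdot>\<^sub>m ((1 / c) \<cdot>\<^sub>m (B * M * mat_diag n S))"
      by (simp only: mult_smult_assoc_mat[OF mult_carrier_mat[OF B(1) M] smult_carrier_mat[OF mat_diag_dim]]
          mult_smult_distrib[OF mult_carrier_mat[OF B(1) M] mat_diag_dim])
    also have "\<dots> = B * M * mat_diag n S"
      using c(1) by (intro eq_matI) simp_all
    also have "\<dots> = B * (G * ?V)"
      using B(1) M by (simp add: assoc_mult_mat[of _ k k _ n _ n] MS)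
    also have "\<dots> = ?V"
      using B G(1) V by (simp flip: assoc_mult_mat[of _ k k _ k _ n])
    finally show ?thesis by simp
  qed
  ultimately have "(M, ?V) \<in> X_rel k n"
    unfolding X_rel_iff using X VX B(1) S(1) c(1)
    by (intro conjI exI[of _ "c \<cdot>\<^sub>m B"] exI[of _ "\<lambda>i. S i / c"]) auto
  moreover have "?v \<in> lyndon_words k (n - k)"
    using lyn vand(1) by (simp add: lyndon_words_altdef[OF k0(2)])
  ultimately show thesis by (intro that)
qed

theorem corollary5p4:
  fixes k n :: nat
  assumes "2 \<le> k" and "k \<le> n - 2"
  shows "finite (PK_critical_points k n)
    \<and> real (card (PK_critical_points k n)) \<le> PK_bound k n
    \<and> PK_bound k n = real (card (lyndon_words k (n - k)))"
proof -
  have k: "1 \<le> k" "k < n" using assms by auto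
  let ?L = "lyndon_words k (n - k)"
  let ?cls = "\<lambda>w. X_rel k n `` {vandermonde n (ones w) n}"
  have sub: "PK_critical_points k n \<subseteq> ?cls ` ?L"
  proof
    fix C assume "C \<in> PK_critical_points k n"
    then obtain M where C: "C \<in> X_mats k n // X_rel k n" and M: "M \<in> C" "PK_critical k n M"
      by (auto simp: PK_critical_points_def Xbar_def)
    have X: "M \<in> X_mats k n" using C M(1) equiv_X_rel in_quotient_imp_subset by blast
    obtain w where w: "w \<in> ?L" "(M, vandermonde n (ones w) n) \<in> X_rel k n"
      using critical_imp_vandermonde[OF k X M(2)] by blast
    have "C = X_rel k n `` {M}"
      using C M(1) equiv_X_rel[of k n] by (metis Image_singleton_iff equiv_class_eq quotientE)
    also have "\<dots> = ?cls w" using equiv_class_eq[OF equiv_X_rel w(2)] .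
    finally show "C \<in> ?cls ` ?L" using w(1) by blast
  qed
  have fin: "finite ?L"
    using k finite_words[of n k] by (simp add: lyndon_words_altdef)
  have "finite (PK_critical_points k n)" "card (PK_critical_points k n) \<le> card ?L"
    using finite_surj[OF fin sub] surj_card_le[OF fin sub] .
  moreover have "PK_bound k n = real (card ?L)"
    using PK_bound_eq_card_lyndon[of k n] k by simp
  ultimately show ?thesis by simp
qed

end
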